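(* Let $v\in C^\circ$ be generic, and let $\xi_{c,d,I}$ be the numbers attached to $v$ in the context. Let $(\Phi_c)_{c\in C\cap N}$ be a solution of $\mathrm{bbGKZ}(C,0)$ and $(\Psi_d)_{d\in C^\circ\cap N}$ a solution of $\mathrm{bbGKZ}(C^\circ,0)$, both consisting of holomorphic functions on a common connected open set $U\subseteq\mathbb{C}^n$. Then the function $$\langle\Phi,\Psi\rangle=\sum_{c,d,I}\xi_{c,d,I}\,\operatorname{Vol}_I\Big(\prod_{i\in I}x_i\Big)\Phi_c\,\Psi_d$$ is constant on $U$. Here the sum is over all subsets $I\subseteq\{1,\dots,n\}$ with $|I|=\operatorname{rk}N$ and all $c\in C\cap N$, $d\in C^\circ\cap N$ with $c+d=\sum_{i\in I}v_i$ (it is a finite sum).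
   Context: Setting. $N$ is a lattice (free abelian group of finite rank $\operatorname{rk}N$), $N_{\mathbb R}=N\otimes\mathbb R$, $N^\vee=\operatorname{Hom}(N,\mathbb Z)$, $\deg:N\to\mathbb Z$ is a linear function, and $C\subset N_{\mathbb R}$ is a full-dimensional rational polyhedral cone all of whose ray generators have degree $1$. $C^\circ$ is the interior of $C$. $v_1,\dots,v_n$ are distinct lattice points of $C$ with $\deg(v_i)=1$, including all ray generators of $C$. $\mathrm{bbGKZ}(C,0)$ is the system of PDEs for a collection of functions $\{\Phi_c(x_1,\dots,x_n)\}_{c\in C\cap N}$: $$\partial_i\Phi_c=\Phi_{c+v_i},\qquad \sum_{i=1}^n\langle\mu,v_i\rangle x_i\partial_i\Phi_c+\langle\mu,c\rangle\Phi_c=0$$ for all $\mu\in N^\vee$, $c\in C\cap N$, $i=1,\dots,n$. $\mathrm{bbGKZ}(C^\circ,0)$ is the same system with indices $c$ running over $C^\circ\cap N$ only. For $I\subseteq\{1,\dots,n\}$ with $|I|=\operatorname{rk}N$: $\operatorname{Vol}_I$ is the absolute value of the determinant of the coordinates of $v_i$, $i\in I$, in a basis of $N$; $\sigma_I=\sum_{i\in I}\mathbb R_{\ge0}v_i$ and $\sigma_I^\circ$ is its interior. "$v\in C^\circ$ generic" means that $v$ does not lie in any proper linear subspace of $N_{\mathbb R}$ spanned by a subset of $\{v_1,\dots,v_n\}$. For $c\in C\cap N$, $d\in C^\circ\cap N$ and $I$ with $|I|=\operatorname{rk}N$ and $c+d=\sum_{i\in I}v_i$, set $\xi_{c,d,I}=(-1)^{\deg(c)}$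 if $\dim\sigma_I=\operatorname{rk}N$ and both $c+\varepsilon v\in\sigma_I^\circ$ and $d-\varepsilon v\in\sigma_I^\circ$ for all sufficiently small $\varepsilon>0$; otherwise $\xi_{c,d,I}=0$. *)

theory Defs
  imports "HOL-Analysis.Analysis"
begin

text \<open>
  The lattice \<open>N\<close>, of rank \<open>CARD('r)\<close>, is \<open>int ^ 'r\<close>; the space \<open>N\<^sub>\<real>\<close> is \<open>real ^ 'r\<close>, and
  \<open>to_real\<close> is the inclusion of \<open>N\<close> in \<open>N\<^sub>\<real>\<close>. The lattice points \<open>v\<^sub>i\<close> are indexed by a finite
  type \<open>'n\<close>, so that the variables \<open>x = (x\<^sub>i)\<close> range over \<open>complex ^ 'n\<close>.
\<close>

definition to_real :: "int ^ 'r \<Rightarrow> real ^ 'r" where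
  "to_real c = (\<chi> j. real_of_int (c $ j))"

definition generated_cone :: "('i \<Rightarrow> real ^ 'r) \<Rightarrow> 'i set \<Rightarrow> (real ^ 'r) set" where
  "generated_cone f S = {\<Sum>i\<in>S. a i *\<^sub>R f i | a. \<forall>i\<in>S. 0 \<le> a i}"

text \<open>A cone is understood to be pointed, so that it is generated by its ray generators.\<close>

definition rational_polyhedral_cone :: "(real ^ 'r) set \<Rightarrow> bool" where
  "rational_polyhedral_cone C \<longleftrightarrow>
     (\<exists>G. finite G \<and> C = generated_cone to_real G) \<and> C \<inter> uminus ` C = {0}"

definition primitive :: "int ^ 'r \<Rightarrow> bool" where
  "primitive u \<longleftrightarrow> (\<forall>k w. u = k *s w \<longrightarrow> \<bar>k\<bar> = 1)"

definition ray_generator :: "(real ^ 'r) set \<Rightarrow> int ^ 'r \<Rightarrow> bool" where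
  "ray_generator C u \<longleftrightarrow> primitive u \<and> {t *\<^sub>R to_real u | t. 0 \<le> t} face_of C"

definition cone_points :: "(real ^ 'r) set \<Rightarrow> (int ^ 'r) set" where
  "cone_points K = {c. to_real c \<in> K}"

text \<open>Homomorphisms from \<open>N\<close> to the integers, that is, the elements of the dual lattice.\<close>

definition dual_lattice :: "(int ^ 'r \<Rightarrow> int) set" where
  "dual_lattice = {\<mu>. \<forall>a b. \<mu> (a + b) = \<mu> a + \<mu> b}"

text \<open>Holomorphy in several variables: the Frechet derivative exists and is complex linear.\<close>

definition holomorphic_on_n :: "(complex ^ 'n \<Rightarrow> complex) \<Rightarrow> (complex ^ 'n) set \<Rightarrow> bool" where
  "holomorphic_on_n f U \<longleftrightarrow>
     (\<forall>x\<in>U. \<exists>L. (f has_derivative L) (at x) \<and> (\<forall>a y. L (a *s y) = a * L y))"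

definition partial_deriv :: "'n \<Rightarrow> (complex ^ 'n \<Rightarrow> complex) \<Rightarrow> complex ^ 'n \<Rightarrow> complex" where
  "partial_deriv i f x = deriv (\<lambda>z. f (x + z *s axis i 1)) 0"

text \<open>
  The family \<open>\<Phi>\<close> is a solution on \<open>U\<close> of the system with indices in \<open>K \<inter> N\<close>, consisting of
  holomorphic functions; \<open>K = C\<close> and \<open>K = interior C\<close> give the systems \<open>bbGKZ(C,0)\<close> and
  \<open>bbGKZ(C\<^sup>\<circ>,0)\<close>. Values of \<open>\<Phi>\<close> at other indices are irrelevant.
\<close>

definition bbGKZ_solution ::
  "('n::finite \<Rightarrow> int ^ 'r) \<Rightarrow> (real ^ 'r) set \<Rightarrow> (complex ^ 'n) set
     \<Rightarrow> (int ^ 'r \<Rightarrow> complex ^ 'n \<Rightarrow> complex) \<Rightarrow> bool" where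
  "bbGKZ_solution v K U \<Phi> \<longleftrightarrow>
     (\<forall>c\<in>cone_points K. holomorphic_on_n (\<Phi> c) U) \<and>
     (\<forall>c\<in>cone_points K. \<forall>i. \<forall>x\<in>U. partial_deriv i (\<Phi> c) x = \<Phi> (c + v i) x) \<and>
     (\<forall>\<mu>\<in>dual_lattice. \<forall>c\<in>cone_points K. \<forall>x\<in>U.
        (\<Sum>i\<in>UNIV. of_int (\<mu> (v i)) * x $ i * partial_deriv i (\<Phi> c) x)
          + of_int (\<mu> c) * \<Phi> c x = 0)"

text \<open>
  To form the determinant, the vectors \<open>v\<^sub>i\<close>, \<open>i \<in> I\<close>, are listed along an arbitrary bijection from
  \<open>'r\<close> to \<open>I\<close>; its absolute value does not depend on the bijection. Only used when
  \<open>card I = CARD('r)\<close>.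
\<close>

definition Vol :: "('n \<Rightarrow> int ^ 'r) \<Rightarrow> 'n set \<Rightarrow> int" where
  "Vol v I = (let e = (SOME e. bij_betw e (UNIV :: 'r set) I) in \<bar>det (\<chi> k. v (e k))\<bar>)"

definition sigma :: "('n \<Rightarrow> int ^ 'r) \<Rightarrow> 'n set \<Rightarrow> (real ^ 'r) set" where
  "sigma v I = generated_cone (\<lambda>i. to_real (v i)) I"

definition generic :: "('n \<Rightarrow> int ^ 'r) \<Rightarrow> real ^ 'r \<Rightarrow> bool" where
  "generic v w \<longleftrightarrow>
     (\<forall>S. span ((\<lambda>i. to_real (v i)) ` S) \<noteq> UNIV \<longrightarrow> w \<notin> span ((\<lambda>i. to_real (v i)) ` S))"

definition xi :: "(int ^ 'r \<Rightarrow> int) \<Rightarrow> ('n \<Rightarrow> int ^ 'r) \<Rightarrow> real ^ 'r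
    \<Rightarrow> int ^ 'r \<Rightarrow> int ^ 'r \<Rightarrow> 'n set \<Rightarrow> complex" where
  "xi deg v w c d I =
     (if dim (sigma v I) = CARD('r) \<and>
         (\<forall>\<^sub>F \<epsilon> in at_right 0. to_real c + \<epsilon> *\<^sub>R w \<in> interior (sigma v I) \<and>
                           to_real d - \<epsilon> *\<^sub>R w \<in> interior (sigma v I))
      then (-1) powi deg c else 0)"

definition pairing_index :: "(real ^ 'r) set \<Rightarrow> ('n \<Rightarrow> int ^ 'r)
    \<Rightarrow> ((int ^ 'r) \<times> (int ^ 'r) \<times> 'n set) set" where
  "pairing_index C v =
     {(c, d, I). card I = CARD('r) \<and> c \<in> cone_points C \<and> d \<in> cone_points (interior C) \<and>
                 c + d = (\<Sum>i\<in>I. v i)}"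

definition pairing :: "(real ^ 'r) set \<Rightarrow> (int ^ 'r \<Rightarrow> int) \<Rightarrow> ('n \<Rightarrow> int ^ 'r) \<Rightarrow> real ^ 'r
    \<Rightarrow> (int ^ 'r \<Rightarrow> complex ^ 'n \<Rightarrow> complex) \<Rightarrow> (int ^ 'r \<Rightarrow> complex ^ 'n \<Rightarrow> complex)
    \<Rightarrow> complex ^ 'n \<Rightarrow> complex" where
  "pairing C deg v w \<Phi> \<Psi> x =
     (\<Sum>(c, d, I)\<in>pairing_index C v.
        xi deg v w c d I * of_int (Vol v I) * (\<Prod>i\<in>I. x $ i) * \<Phi> c x * \<Psi> d x)"

end

theory Submission
  imports Defs
begin

text \<open>
  Differentiate the pairing with respect to \<open>x\<^sub>j\<close> and use the equations for the functional that
  vanishes on \<open>v\<^sub>i\<close>, \<open>i \<in> I - {j}\<close>, to remove the terms that come from differentiating the monomial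
  when \<open>j \<in> I\<close>. The remaining terms are grouped by the sets \<open>K\<close> of size \<open>rk N + 1\<close> and by
  \<open>c + d = \<Sum>\<^sub>K v\<^sub>k\<close>. Their coefficient is a signed count of the endpoints of the segment in which
  the line \<open>{a. \<Sum>\<^sub>K a\<^sub>k v\<^sub>k = c + \<epsilon> w}\<close> meets the cube \<open>[0,1]\<^sup>K\<close>, and one endpoint is an entry, the
  other an exit.
\<close>

section \<open>Boxes and segments in a cube\<close>

text \<open>For \<open>I\<close> containing \<open>j\<close> the functional is a cofactor functional
  \<mu>: the determinant with the row of \<open>v j\<close> left free. Since it equals
  \<open>Vol v I\<close> at \<open>v j\<close> and vanishes on the rest of \<open>I\<close>, adding
  the equations of \<Phi> at \<open>c\<close> and of \<Psi> at \<open>d\<close> gives the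
  coefficient \<mu> c + \<mu> d = \<mu> (sum v I) = \<open>Vol v I\<close>, exactly the factor in
  the pairing. At \<open>v i\<close> with \<open>i\<close> outside \<open>I\<close> it gives, up to
  sign, the volume of \<open>I\<close> with \<open>j\<close> exchanged for \<open>i\<close>. That
  sign is the obstacle, because absolute values of determinants have forgotten it. It is recovered
  from a linear relation \<open>n\<close> among the r + 1 vectors of \<open>K\<close>, where r = rk
  N: applying \<mu> to the relation expresses the sign through the signs of the coefficients, and
  the same \<open>n\<close> is the direction of the line through the cube. The factor (-1)^deg c
  makes the contributions of \<open>c\<close> and \<open>c - v k\<close> differ in sign, as deg (v
  k) = 1; this produces the difference between the facets 0 and 1. Genericity of \<open>w\<close>
  has two uses: the line never meets two facets at once, and every membership condition is constant
  for small eps, so one eps serves all boxes.\<close>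

lemma interval_endpoint_count:
  fixes l u :: "'k \<Rightarrow> real"
  assumes "finite F" "F \<noteq> {}"
    and "\<And>k. k \<in> F \<Longrightarrow> l k < u k"
    and "inj_on l F"
  shows "(\<Sum>k\<in>F. of_bool (\<forall>i\<in>F - {k}. l i < l k \<and> l k < u i) :: real)
           = of_bool (Max (l ` F) < Min (u ` F))"
proof -
  \<comment> \<open>Only the index with the largest left endpoint can qualify, and injectivity makes
    it unique. It does qualify iff that endpoint precedes all right endpoints.\<close>
  have "Max (l ` F) \<in> l ` F" using assms by (intro Max_in) auto
  then obtain m where m: "m \<in> F" "l m = Max (l ` F)" by auto
  have lm: "l i < l m" if "i \<in> F - {m}" for i
  proof -
    have "l i \<le> l m" unfolding m(2) using that assms(1) by (intro Max_ge) auto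
    moreover have "l i \<noteq> l m" using that m(1) assms(4) by (metis Diff_iff inj_onD singletonI)
    ultimately show ?thesis by simp
  qed
  have eq: "(\<forall>i\<in>F - {k}. l i < l k \<and> l k < u i) \<longleftrightarrow> k = m \<and> l m < Min (u ` F)" if "k \<in> F" for k
  proof
    assume k: "\<forall>i\<in>F - {k}. l i < l k \<and> l k < u i"
    have "k = m" using k lm m that by (metis DiffI not_less_iff_gr_or_eq singletonD)
    moreover have "l m < Min (u ` F)"
      using assms k that \<open>k = m\<close> by (subst Min_gr_iff) auto
    ultimately show "k = m \<and> l m < Min (u ` F)" by simp
  next
    assume "k = m \<and> l m < Min (u ` F)"
    then show "\<forall>i\<in>F - {k}. l i < l k \<and> l k < u i" using lm assms by auto
  qed
  have "(\<Sum>k\<in>F. of_bool (\<forall>i\<in>F - {k}. l i < l k \<and> l k < u i) :: real)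
        = (\<Sum>k\<in>F. if k = m then of_bool (l m < Min (u ` F)) else 0)"
    by (intro sum.cong refl) (simp add: eq)
  also have "\<dots> = of_bool (l m < Min (u ` F))" using m assms by simp
  finally show ?thesis using m by simp
qed

text \<open>If the open intervals have a common point, their intersection has one left and one right
  end; otherwise both counts are zero. Right endpoints are reduced to left ones by the reflection t
  -> -t, which preserves the criterion Max l < Min u.\<close>

lemma interval_endpoints_balance:
  fixes l u :: "'k \<Rightarrow> real"
  assumes "finite F" "F \<noteq> {}"
    and lu: "\<And>k. k \<in> F \<Longrightarrow> l k < u k"
    and "inj_on l F" "inj_on u F"
  shows "(\<Sum>k\<in>F. of_bool (\<forall>i\<in>F - {k}. l i < l k \<and> l k < u i) :: real)
       = (\<Sum>k\<in>F. of_bool (\<forall>i\<in>F - {k}. l i < u k \<and> u k < u i))"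
proof -
  have M: "Max ((\<lambda>k. - g k) ` F) = - Min (g ` F)" for g :: "'k \<Rightarrow> real"
  proof (rule Max_eqI)
    have "Min (g ` F) \<in> g ` F" using assms by (intro Min_in) auto
    then show "- Min (g ` F) \<in> (\<lambda>k. - g k) ` F" by auto
  qed (use assms in auto)
  have "(\<Sum>k\<in>F. of_bool (\<forall>i\<in>F - {k}. - u i < - u k \<and> - u k < - l i) :: real)
         = of_bool (Max ((\<lambda>k. - u k) ` F) < Min ((\<lambda>k. - l k) ` F))"
    by (rule interval_endpoint_count) (use assms in \<open>auto simp: inj_on_def\<close>)
  moreover have "Min ((\<lambda>k. - l k) ` F) = - Max (l ` F)"
    using M[of "\<lambda>k. - l k"] by simp
  ultimately have "(\<Sum>k\<in>F. of_bool (\<forall>i\<in>F - {k}. u k < u i \<and> l i < u k) :: real)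
         = of_bool (Max (l ` F) < Min (u ` F))"
    by (simp add: M)
  then show ?thesis
    using interval_endpoint_count[OF assms(1,2) lu assms(4)] by (simp add: conj_commute)
qed

section \<open>Coordinates in a basis, simplicial cones and open parallelepipeds\<close>

lemma spanning_inj_independent:
  fixes f :: "'i \<Rightarrow> real ^ 'r::finite"
  assumes "finite I" "card I = CARD('r)" "span (f ` I) = UNIV"
  shows "inj_on f I" "independent (f ` I)"
proof -
  have le: "CARD('r) \<le> card (f ` I)"
    using span_card_ge_dim[of "f ` I" UNIV] assms by auto
  then show "inj_on f I"
    using assms card_image_le[of I f] by (intro eq_card_imp_inj_on) auto
  show "independent (f ` I)"
    by (rule card_le_dim_spanning[of _ UNIV]) (use assms card_image_le[of I f] in auto)
qed

text \<open>The dual basis, indexed by \<open>I\<close> instead of by the basis vectors, to match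
  the indexing of the \<open>v i\<close>.\<close>

definition is_coordinates :: "('i \<Rightarrow> 'a::real_vector) \<Rightarrow> 'i set \<Rightarrow> ('i \<Rightarrow> 'a \<Rightarrow> real) \<Rightarrow> bool" where
  "is_coordinates f I L \<longleftrightarrow> (\<forall>i. linear (L i)) \<and> (\<forall>q. (\<Sum>i\<in>I. L i q *\<^sub>R f i) = q) \<and>
     (\<forall>i\<in>I. \<forall>a. L i (\<Sum>k\<in>I. a k *\<^sub>R f k) = a i)"

lemma is_coordinatesD:
  assumes "is_coordinates f I L"
  shows "linear (L i)" "(\<Sum>i\<in>I. L i q *\<^sub>R f i) = q"
    and "i \<in> I \<Longrightarrow> L i (\<Sum>k\<in>I. a k *\<^sub>R f k) = a i"
  using assms by (auto simp: is_coordinates_def)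

lemma obtain_coordinates:
  fixes f :: "'i \<Rightarrow> real ^ 'r::finite"
  assumes "finite I" "card I = CARD('r)" "span (f ` I) = UNIV"
  obtains L where "is_coordinates f I L"
proof -
  note ii = spanning_inj_independent[OF assms]
  define L where "L i q = representation (f ` I) q (f i)" for i q
  have lin: "linear (L i)" for i
    unfolding L_def using bounded_linear_representation[OF ii(2) assms(3)]
    by (simp add: bounded_linear.linear)
  have "is_coordinates f I L"
    unfolding is_coordinates_def
  proof (intro conjI allI ballI)
    show "linear (L i)" for i by (rule lin)
    show "(\<Sum>i\<in>I. L i q *\<^sub>R f i) = q" for q
    proof -
      have "(\<Sum>b\<in>f ` I. representation (f ` I) q b *\<^sub>R b) = q"
        using assms ii by (intro real_vector.sum_representation_eq) auto
      then show ?thesis using ii by (simp add: sum.reindex L_def)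
    qed
    show "L i (\<Sum>k\<in>I. a k *\<^sub>R f k) = a i" if "i \<in> I" for a i
    proof -
      have "L i (f k) = (if k = i then 1 else 0)" if "k \<in> I" for k
        using \<open>i \<in> I\<close> that ii by (auto simp: L_def representation_basis dest: inj_onD)
      then have "(\<Sum>k\<in>I. L i (a k *\<^sub>R f k)) = (\<Sum>k\<in>I. if k = i then a i else 0)"
        using lin by (intro sum.cong) (auto simp: linear_cmul)
      then show ?thesis using that assms lin by (simp add: linear_sum)
    qed
  qed
  then show ?thesis by (rule that)
qed

lemma interior_generated_cone:
  fixes f :: "'i \<Rightarrow> real ^ 'r::finite"
  assumes fin: "finite I" "card I = CARD('r)" "span (f ` I) = UNIV"
    and "is_coordinates f I L"
  shows "interior (generated_cone f I) = {q. \<forall>i\<in>I. 0 < L i q}"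
proof (rule antisym)
  note L = is_coordinatesD[OF assms(4)]
  show "interior (generated_cone f I) \<subseteq> {q. \<forall>i\<in>I. 0 < L i q}"
  proof (intro subsetI CollectI ballI)
    fix q i assume q: "q \<in> interior (generated_cone f I)" and i: "i \<in> I"
    \<comment> \<open>A small step back along \<open>f i\<close> stays in the cone and lowers the
      coordinate \<open>i\<close> by \<open>e\<close>; hence that coordinate was positive.\<close>
    have "\<forall>\<^sub>F e in at_right 0. q - e *\<^sub>R f i \<in> interior (generated_cone f I)"
    proof -
      have "((\<lambda>e. q - e *\<^sub>R f i) \<longlongrightarrow> q - 0 *\<^sub>R f i) (at_right 0)"
        by (intro tendsto_intros)
      then show ?thesis using q topological_tendstoD[of _ q] open_interior by fastforce
    qed
    then have "\<forall>\<^sub>F e in at_right 0. 0 < e \<and> q - e *\<^sub>R f i \<in> interior (generated_cone f I)"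
      by (intro eventually_conj eventually_at_right_less)
    then obtain e where e: "0 < e" "q - e *\<^sub>R f i \<in> generated_cone f I"
      using eventually_happens'[OF trivial_limit_at_right_real] interior_subset by (metis (no_types, lifting) subsetD)
    then obtain a where a: "q - e *\<^sub>R f i = (\<Sum>i\<in>I. a i *\<^sub>R f i)" "\<forall>i\<in>I. 0 \<le> a i"
      by (auto simp: generated_cone_def)
    have "f i = (\<Sum>k\<in>I. (if k = i then 1 else 0) *\<^sub>R f k)"
      using i fin by (simp add: if_distrib[of "\<lambda>c. c *\<^sub>R _"] cong: if_cong)
    then have "L i (f i) = 1" using L(3)[OF i, of "\<lambda>k. if k = i then 1 else 0"] by simp
    moreover have "L i (q - e *\<^sub>R f i) = a i" using a L(3) i by simp
    ultimately have "L i q = a i + e" using L(1) by (simp add: linear_diff linear_cmul)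
    then show "0 < L i q" using a e i by (simp add: add_nonneg_pos)
  qed
next
  note L = is_coordinatesD[OF assms(4)]
  show "{q. \<forall>i\<in>I. 0 < L i q} \<subseteq> interior (generated_cone f I)"
  proof (rule interior_maximal)
    show "{q. \<forall>i\<in>I. 0 < L i q} \<subseteq> generated_cone f I"
    proof
      fix q assume "q \<in> {q. \<forall>i\<in>I. 0 < L i q}"
      then have "\<forall>i\<in>I. 0 \<le> L i q" by (auto intro: less_imp_le)
      then show "q \<in> generated_cone f I"
        unfolding generated_cone_def by (intro CollectI exI[of _ "\<lambda>i. L i q"]) (simp add: L(2))
    qed
    have "{q. \<forall>i\<in>I. 0 < L i q} = (\<Inter>i\<in>I. {q. 0 < L i q})" by auto
    also have "open \<dots>"
      using fin L(1) by (intro open_INT ballI open_Collect_less continuous_on_const linear_continuous_on)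
        (auto simp: linear_conv_bounded_linear)
    finally show "open {q. \<forall>i\<in>I. 0 < L i q}" .
  qed
qed

text \<open>For a basis this is the open parallelepiped with all coordinates strictly between 0 and
  1. The form with two cones is that of the condition in \<open>xi\<close>, with \<open>q\<close> =
  c + eps w and the complementary point d - eps w; the span clause plays the part of the dimension
  condition there.\<close>

definition in_box :: "('i \<Rightarrow> real ^ 'r) \<Rightarrow> 'i set \<Rightarrow> real ^ 'r \<Rightarrow> bool" where
  "in_box f I q \<longleftrightarrow> span (f ` I) = UNIV \<and> q \<in> interior (generated_cone f I) \<and>
     (\<Sum>i\<in>I. f i) - q \<in> interior (generated_cone f I)"

lemma in_box_coordinates:
  fixes f :: "'i \<Rightarrow> real ^ 'r::finite"
  assumes fin: "finite I" "card I = CARD('r)" "span (f ` I) = UNIV"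
    and "is_coordinates f I L"
  shows "in_box f I q \<longleftrightarrow> (\<forall>i\<in>I. 0 < L i q \<and> L i q < 1)"
proof -
  note L = is_coordinatesD[OF assms(4)]
  have "L i (\<Sum>i\<in>I. f i) = 1" if "i \<in> I" for i
    using L(3)[OF that, of "\<lambda>_. 1"] by simp
  then have "L i ((\<Sum>i\<in>I. f i) - q) = 1 - L i q" if "i \<in> I" for i
    using that L(1)[of i] by (simp add: linear_diff)
  then show ?thesis
    unfolding in_box_def using fin by (subst (1 2) interior_generated_cone[OF assms]) auto
qed

lemma in_box_sum_iff:
  fixes f :: "'i \<Rightarrow> real ^ 'r::finite"
  assumes "finite I" "card I = CARD('r)" "span (f ` I) = UNIV"
  shows "in_box f I (\<Sum>i\<in>I. a i *\<^sub>R f i) \<longleftrightarrow> (\<forall>i\<in>I. 0 < a i \<and> a i < 1)"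
proof -
  obtain L where L: "is_coordinates f I L"
    using obtain_coordinates[OF assms] by blast
  show ?thesis
    unfolding in_box_coordinates[OF assms L] by (simp add: is_coordinatesD(3)[OF L])
qed

section \<open>General position and cancellation along a line through the cube\<close>

lemma span_small_not_UNIV:
  fixes f :: "'i \<Rightarrow> real ^ 'r::finite"
  assumes "finite B" "card B < CARD('r)"
  shows "span (f ` B) \<noteq> UNIV"
  using span_card_ge_dim[of "f ` B" UNIV] card_image_le[OF assms(1), of f] assms by auto

lemma in_span_image_iff:
  fixes f :: "'i \<Rightarrow> 'a::real_vector"
  assumes "finite S"
  shows "q \<in> span (f ` S) \<longleftrightarrow> (\<exists>a. q = (\<Sum>i\<in>S. a i *\<^sub>R f i))"
proof
  assume "q \<in> span (f ` S)"
  then show "\<exists>a. q = (\<Sum>i\<in>S. a i *\<^sub>R f i)"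
  proof (induction rule: span_induct_alt)
    case base
    show ?case by (intro exI[of _ "\<lambda>_. 0"]) simp
  next
    case (step c x y)
    then obtain k a where k: "x = f k" "k \<in> S" "y = (\<Sum>i\<in>S. a i *\<^sub>R f i)" by auto
    then have "c *\<^sub>R x + y = (\<Sum>i\<in>S. (a(k := a k + c)) i *\<^sub>R f i)"
      using assms by (simp add: sum.remove[of S k] algebra_simps)
    then show ?case by blast
  qed
qed (auto intro!: span_sum span_scale intro: span_base)

text \<open>If the line of representations of \<open>p\<close> met the facets "coordinate
  \<open>k\<close> is \<open>s\<close>" and "coordinate \<open>i\<close> is \<open>s'\<close>" at
  once, the shifted point would lie in the span of the r - 1 remaining vectors. This is the
  coincidence to be excluded.\<close>

definition general_position :: "('i \<Rightarrow> 'a::real_vector) \<Rightarrow> 'a \<Rightarrow> bool" where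
  "general_position f p \<longleftrightarrow> (\<forall>i k B. \<forall>s\<in>{0, 1}. \<forall>s'\<in>{0, 1}.
     span (f ` B) \<noteq> UNIV \<longrightarrow> p - s *\<^sub>R f k - s' *\<^sub>R f i \<notin> span (f ` B))"

text \<open>
  The points \<open>a + t n\<close> are all the representations of \<open>p\<close> as a combination of the \<open>f\<^sub>k\<close>. This line
  enters and leaves the cube \<open>[0,1]\<^sup>K\<close> through one facet each; the box \<open>K - {k}\<close> at \<open>p\<close> or at
  \<open>p - f\<^sub>k\<close> records a passage through the facet where the \<open>k\<close>th coordinate is \<open>0\<close> or \<open>1\<close>, and
  \<open>sgn (n k)\<close> makes entries count positively and exits negatively.
\<close>

lemma signed_boxes_cancel:
  fixes f :: "'i \<Rightarrow> real ^ 'r::finite" and n :: "'i \<Rightarrow> real"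
  assumes K: "finite K" "card K = Suc CARD('r)" "span (f ` K) = UNIV"
    and n: "(\<Sum>k\<in>K. n k *\<^sub>R f k) = 0" "\<exists>k\<in>K. n k \<noteq> 0"
    and general: "general_position f p"
  shows "(\<Sum>k\<in>K. sgn (n k) * (of_bool (in_box f (K - {k}) p) - of_bool (in_box f (K - {k}) (p - f k)))) = 0"
    and "\<And>k. k \<in> K \<Longrightarrow> n k = 0 \<Longrightarrow> span (f ` (K - {k})) \<noteq> UNIV"
proof -
  have cardK: "card (K - {k}) = CARD('r)" if "k \<in> K" for k using K that by simp
  \<comment> \<open>A zero coefficient leaves a nontrivial relation among the other vectors, and r
    dependent vectors cannot span.\<close>
  show "span (f ` (K - {k})) \<noteq> UNIV" if k: "k \<in> K" "n k = 0" for k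
  proof
    assume sp: "span (f ` (K - {k})) = UNIV"
    have "finite (K - {k})" using K(1) by simp
    then obtain L where "is_coordinates f (K - {k}) L"
      using obtain_coordinates[OF _ cardK[OF k(1)] sp] by metis
    note L = is_coordinatesD[OF this]
    have "(\<Sum>j\<in>K - {k}. n j *\<^sub>R f j) = 0" using n(1) k K(1) by (simp add: sum.remove)
    then have "n i = 0" if "i \<in> K - {k}" for i using L(3)[OF that, of n] L(1)[of i] by (simp add: linear_0)
    then show False using n(2) k by auto
  qed
  \<comment> \<open>A nonzero coefficient allows the relation to be solved for
    \<open>f k\<close>.\<close>
  have span: "span (f ` (K - {k})) = UNIV" if k: "k \<in> K" "n k \<noteq> 0" for k
  proof -
    have "n k *\<^sub>R f k = - (\<Sum>i\<in>K - {k}. n i *\<^sub>R f i)"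
      using n(1) k K(1) by (simp add: sum.remove eq_neg_iff_add_eq_0)
    also have "\<dots> \<in> span (f ` (K - {k}))"
      by (auto intro!: span_neg span_sum span_scale intro: span_base)
    finally have "f k \<in> span (f ` (K - {k}))" using k(2) span_scale[of "n k *\<^sub>R f k" _ "1 / n k"] by simp
    then have "f ` K \<subseteq> span (f ` (K - {k}))" using span_base[of _ "f ` (K - {k})"] by auto
    then have "span (f ` K) \<subseteq> span (f ` (K - {k}))" by (rule span_minimal) simp
    then show ?thesis using K(3) by auto
  qed
  obtain a where a: "p = (\<Sum>k\<in>K. a k *\<^sub>R f k)"
    using in_span_image_iff[OF K(1), of p f] K(3) by auto
  have line: "p = (\<Sum>k\<in>K. (a k + t * n k) *\<^sub>R f k)" for t
    using n(1) by (simp add: a algebra_simps sum.distrib flip: scaleR_scaleR scaleR_sum_right)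
  \<comment> \<open>Only the coordinates in \<open>F\<close> move along the line;
    \<open>hit s k\<close> is the time at which coordinate \<open>k\<close> has the value
    \<open>s\<close>.\<close>
  define F where "F = {k \<in> K. n k \<noteq> 0}"
  define hit where "hit s k = (s - a k) / n k" for s k
  define good where "good k t \<longleftrightarrow> (\<forall>i\<in>K - {k}. 0 < a i + t * n i \<and> a i + t * n i < 1)" for k t
  have rest: "p - s *\<^sub>R f k = (\<Sum>i\<in>K - {k}. (a i + hit s k * n i) *\<^sub>R f i)" if "k \<in> F" for s k
  proof -
    have k: "k \<in> K" "a k + hit s k * n k = s" using that by (auto simp: F_def hit_def)
    have "p = (a k + hit s k * n k) *\<^sub>R f k + (\<Sum>i\<in>K - {k}. (a i + hit s k * n i) *\<^sub>R f i)"
      by (rule trans[OF line sum.remove[OF K(1) k(1)]])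
    then show ?thesis unfolding k(2) by simp
  qed
  have box: "in_box f (K - {k}) (p - s *\<^sub>R f k) \<longleftrightarrow> good k (hit s k)" if "k \<in> F" for s k
    unfolding rest[OF that] good_def
    by (rule in_box_sum_iff) (use that K(1) cardK span in \<open>auto simp: F_def\<close>)
  have distinct: "hit s k \<noteq> hit s' i"
    if "k \<in> F" "i \<in> F" "i \<noteq> k" and s: "s \<in> {0, 1}" "s' \<in> {0, 1}" for s s' i k
  proof
    assume eq: "hit s k = hit s' i"
    have ik: "i \<in> K - {k}" using that by (simp add: F_def)
    have hi: "a i + hit s k * n i = s'" unfolding eq using that(2) by (simp add: F_def hit_def)
    have "p - s *\<^sub>R f k = (a i + hit s k * n i) *\<^sub>R f i
        + (\<Sum>j\<in>K - {k} - {i}. (a j + hit s k * n j) *\<^sub>R f j)"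
      by (rule trans[OF rest[OF that(1)] sum.remove[OF _ ik]]) (simp add: K(1))
    note this[unfolded hi]
    then have "p - s *\<^sub>R f k - s' *\<^sub>R f i = (\<Sum>j\<in>K - {k} - {i}. (a j + hit s k * n j) *\<^sub>R f j)"
      by simp
    also have "\<dots> \<in> span (f ` (K - {k} - {i}))"
      by (intro span_sum span_scale span_base) auto
    finally have "span (f ` (K - {k} - {i})) = UNIV" using general s unfolding general_position_def by blast
    moreover have "card (K - {k} - {i}) < CARD('r)"
      using ik that(1) cardK[of k] K(1) by (simp add: F_def card_Diff_singleton)
    ultimately show False using span_small_not_UNIV[of "K - {k} - {i}" f] K(1) by blast
  qed
  \<comment> \<open>Coordinate \<open>k\<close> is in the open unit interval exactly between the
    times \<open>l k\<close> and \<open>u k\<close>; a negative \<open>n k\<close> interchanges the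
    walls 0 and 1.\<close>
  define l where "l k = (if 0 < n k then hit 0 k else hit 1 k)" for k
  define u where "u k = (if 0 < n k then hit 1 k else hit 0 k)" for k
  have ab: "0 < a i + t * n i \<and> a i + t * n i < 1 \<longleftrightarrow> l i < t \<and> t < u i" if "i \<in> F" for i t
    using that by (auto simp: F_def l_def u_def hit_def divide_simps algebra_simps)
  \<comment> \<open>The coordinates outside \<open>F\<close> are constant along the line, so they
    impose one common condition on all summands.\<close>
  define Q where "Q \<longleftrightarrow> (\<forall>i\<in>K - F. 0 < a i \<and> a i < 1)"
  have good: "good k t \<longleftrightarrow> Q \<and> (\<forall>i\<in>F - {k}. l i < t \<and> t < u i)" if "k \<in> F" for k t
  proof -
    have "K - {k} = (K - F) \<union> (F - {k})" using that by (auto simp: F_def)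
    then have "good k t \<longleftrightarrow> (\<forall>i\<in>K - F. 0 < a i + t * n i \<and> a i + t * n i < 1)
        \<and> (\<forall>i\<in>F - {k}. 0 < a i + t * n i \<and> a i + t * n i < 1)"
      unfolding good_def by (simp only: ball_Un)
    also have "(\<forall>i\<in>K - F. 0 < a i + t * n i \<and> a i + t * n i < 1) \<longleftrightarrow> Q"
      unfolding Q_def by (intro ball_cong refl) (simp add: F_def)
    also have "(\<forall>i\<in>F - {k}. 0 < a i + t * n i \<and> a i + t * n i < 1)
        \<longleftrightarrow> (\<forall>i\<in>F - {k}. l i < t \<and> t < u i)"
      by (intro ball_cong refl ab) simp
    finally show ?thesis .
  qed
  \<comment> \<open>The factor \<open>sgn (n k)\<close> converts "wall 0 minus wall 1" into "left
    end minus right end", which is what the interval count balances.\<close>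
  have summand: "sgn (n k) * (of_bool (in_box f (K - {k}) p) - of_bool (in_box f (K - {k}) (p - f k)))
      = of_bool Q * (of_bool (\<forall>i\<in>F - {k}. l i < l k \<and> l k < u i)
                     - of_bool (\<forall>i\<in>F - {k}. l i < u k \<and> u k < u i))" if k: "k \<in> F" for k
  proof -
    have "in_box f (K - {k}) p \<longleftrightarrow> good k (hit 0 k)" "in_box f (K - {k}) (p - f k) \<longleftrightarrow> good k (hit 1 k)"
      using box[OF k, of 0] box[OF k, of 1] by simp_all
    moreover have "sgn (n k) * (of_bool (good k (hit 0 k)) - of_bool (good k (hit 1 k)))
        = of_bool (good k (l k)) - of_bool (good k (u k))"
      using k by (cases "0 < n k") (auto simp: F_def l_def u_def)
    ultimately show ?thesis by (simp add: good[OF k])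
  qed
  have "(\<Sum>k\<in>K. sgn (n k) * (of_bool (in_box f (K - {k}) p) - of_bool (in_box f (K - {k}) (p - f k))))
      = (\<Sum>k\<in>F. sgn (n k) * (of_bool (in_box f (K - {k}) p) - of_bool (in_box f (K - {k}) (p - f k))))"
    by (rule sum.mono_neutral_right) (use K(1) in \<open>auto simp: F_def\<close>)
  also have "\<dots> = of_bool Q * ((\<Sum>k\<in>F. of_bool (\<forall>i\<in>F - {k}. l i < l k \<and> l k < u i))
                     - (\<Sum>k\<in>F. of_bool (\<forall>i\<in>F - {k}. l i < u k \<and> u k < u i)))"
    by (simp add: summand sum_subtractf flip: sum_distrib_left)
  also have "\<dots> = 0"
  proof -
    have "(\<Sum>k\<in>F. of_bool (\<forall>i\<in>F - {k}. l i < l k \<and> l k < u i) :: real)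
        = (\<Sum>k\<in>F. of_bool (\<forall>i\<in>F - {k}. l i < u k \<and> u k < u i))"
    proof (rule interval_endpoints_balance)
      show "finite F" using K(1) by (simp add: F_def)
      show "F \<noteq> {}" using n(2) by (auto simp: F_def)
      show "l k < u k" if "k \<in> F" for k
        using that by (auto simp: F_def l_def u_def hit_def divide_simps)
      have h: "hit s k \<noteq> hit s' i" if "k \<in> F" "i \<in> F" "i \<noteq> k" "s = 0 \<or> s = 1" "s' = 0 \<or> s' = 1"
        for s s' i k using distinct that by auto
      show "inj_on l F" "inj_on u F"
        using h by (auto simp: inj_on_def l_def u_def)
    qed
    then show ?thesis by simp
  qed
  finally show "(\<Sum>k\<in>K. sgn (n k) * (of_bool (in_box f (K - {k}) p) - of_bool (in_box f (K - {k}) (p - f k)))) = 0" .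
qed

lemma obtain_linear_relation:
  fixes f :: "'i \<Rightarrow> real ^ 'r::finite"
  assumes "finite K" "card K = Suc CARD('r)" "inj_on f K"
  obtains n where "(\<Sum>k\<in>K. n k *\<^sub>R f k) = 0" "\<exists>k\<in>K. n k \<noteq> 0"
proof -
  have "dependent (f ` K)"
    by (rule dependent_biggerset) (simp add: assms card_image)
  then obtain u where "(\<exists>v\<in>f ` K. u v \<noteq> 0)" "(\<Sum>v\<in>f ` K. u v *\<^sub>R v) = 0"
    using assms by (auto simp: dependent_finite)
  then show ?thesis using assms that[of "u \<circ> f"] by (auto simp: sum.reindex)
qed

text \<open>The value \<open>m k (f k)\<close> is known only up to sign. Applying \<open>m k\<close>
  to the relation gives m k (f k) = - sgn (n j) sgn (n k) vol j when both coefficients are nonzero,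
  and the claim becomes the cancellation of signed boxes multiplied by sgn (n j) vol j.\<close>

lemma signed_box_relation:
  fixes f :: "'i \<Rightarrow> real ^ 'r::finite" and m :: "'i \<Rightarrow> real ^ 'r \<Rightarrow> real"
  assumes K: "finite K" "card K = Suc CARD('r)" "inj_on f K"
    and j: "j \<in> K"
    and m: "\<And>k. k \<in> K - {j} \<Longrightarrow> linear (m k)" "\<And>k. k \<in> K - {j} \<Longrightarrow> m k (f j) = vol k"
      "\<And>k i. k \<in> K - {j} \<Longrightarrow> i \<in> K - {k, j} \<Longrightarrow> m k (f i) = 0"
      "\<And>k. k \<in> K - {j} \<Longrightarrow> \<bar>m k (f k)\<bar> = vol j"
    and vol: "\<And>k. k \<in> K \<Longrightarrow> 0 \<le> vol k"
    and general: "general_position f p"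
  defines "\<tau> \<equiv> \<lambda>k. of_bool (in_box f (K - {k}) p) - of_bool (in_box f (K - {k}) (p - f k)) :: real"
  shows "vol j * \<tau> j = (\<Sum>k\<in>K - {j}. m k (f k) * \<tau> k)"
proof (cases "span (f ` K) = UNIV")
  case False
  then have "span (f ` (K - {k})) \<noteq> UNIV" for k
    by (metis Diff_subset image_mono span_mono top.extremum_uniqueI)
  then have "\<tau> k = 0" for k by (simp add: \<tau>_def in_box_def)
  then show ?thesis by simp
next
  case True
  obtain n where n: "(\<Sum>k\<in>K. n k *\<^sub>R f k) = 0" "\<exists>k\<in>K. n k \<noteq> 0"
    using obtain_linear_relation[OF K] by blast
  note cancel = signed_boxes_cancel[OF K(1,2) True n general]
  have \<tau>0: "\<tau> k = 0" if "k \<in> K" "n k = 0" for k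
    using cancel(2)[OF that] by (simp add: \<tau>_def in_box_def)
  have rel: "n k * m k (f k) + n j * vol k = 0" if k: "k \<in> K - {j}" for k
  proof -
    have "0 = m k (\<Sum>i\<in>K. n i *\<^sub>R f i)" using n(1) m(1)[OF k] by (simp add: linear_0)
    also have "\<dots> = (\<Sum>i\<in>K. n i * m k (f i))" using m(1)[OF k] by (simp add: linear_sum linear_cmul)
    also have "\<dots> = n k * m k (f k) + (n j * m k (f j) + (\<Sum>i\<in>K - {k} - {j}. n i * m k (f i)))"
      using k j K(1) sum.remove[of K k "\<lambda>i. n i * m k (f i)"]
        sum.remove[of "K - {k}" j "\<lambda>i. n i * m k (f i)"] by auto
    also have "(\<Sum>i\<in>K - {k} - {j}. n i * m k (f i)) = 0"
      using m(3)[OF k] by (intro sum.neutral) auto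
    finally show ?thesis using m(2)[OF k] by simp
  qed
  show ?thesis
  proof (cases "n j = 0")
    case True
    \<comment> \<open>With \<open>n j\<close> zero, \<open>rel\<close> says that \<open>n k\<close>
      or \<open>m k (f k)\<close> is zero; in the first case the box degenerates.\<close>
    have "m k (f k) * \<tau> k = 0" if "k \<in> K - {j}" for k
      using rel[OF that] \<tau>0[of k] True that by auto
    then show ?thesis using \<tau>0[OF j True] by (metis (no_types, lifting) mult_zero_right sum.neutral)
  next
    case False
    have mk: "m k (f k) * \<tau> k = - sgn (n j) * vol j * (sgn (n k) * \<tau> k)" if k: "k \<in> K - {j}" for k
    proof (cases "n k = 0")
      case True
      then show ?thesis using \<tau>0 k by simp
    next
      case nk: False
      have nm: "n k * m k (f k) = - (n j * vol k)" using rel[OF k] by simp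
      have "sgn (n k) * sgn (m k (f k)) = - sgn (n j) * sgn (vol k)"
        using arg_cong[OF nm, of sgn] by (simp add: sgn_mult sgn_minus)
      \<comment> \<open>Taking absolute values in \<open>nm\<close>, |n k| vol j = |n j| vol k with
        both coefficients nonzero, so the two volumes vanish together.\<close>
      moreover have "sgn (vol k) = sgn (vol j)"
        using arg_cong[OF nm, of abs] m(4)[OF k] vol[of k] vol[OF j] k nk False
        by (auto simp: abs_mult sgn_if)
      ultimately have "sgn (n k) * sgn (m k (f k)) = - sgn (n j) * sgn (vol j)" by simp
      moreover have "sgn (n k) = 1 \<or> sgn (n k) = - 1" using nk by (auto simp: sgn_if)
      ultimately have "sgn (m k (f k)) = - sgn (n j) * sgn (vol j) * sgn (n k)" by auto
      then have "m k (f k) = - sgn (n j) * sgn (vol j) * sgn (n k) * vol j"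
        using m(4)[OF k] by (metis sgn_mult_abs)
      also have "\<dots> = - sgn (n j) * vol j * sgn (n k)"
        using vol[OF j] by (simp add: sgn_if)
      finally show ?thesis by simp
    qed
    have "(\<Sum>k\<in>K - {j}. m k (f k) * \<tau> k) = - sgn (n j) * vol j * (\<Sum>k\<in>K - {j}. sgn (n k) * \<tau> k)"
      unfolding sum_distrib_left by (intro sum.cong refl mk)
    also have "(\<Sum>k\<in>K - {j}. sgn (n k) * \<tau> k) = - (sgn (n j) * \<tau> j)"
      using cancel(1) j K(1) by (simp add: sum.remove[of K j] \<tau>_def eq_neg_iff_add_eq_0)
    also have "- sgn (n j) * vol j * - (sgn (n j) * \<tau> j) = vol j * \<tau> j"
      using False by (simp add: sgn_if)
    finally show ?thesis by simp
  qed
qed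

section \<open>Generic directions\<close>

text \<open>A coefficient is zero when its condition merely fails to hold eventually. Decidedness
  strengthens this to eventual failure, so that the value can be read off at a single small
  eps.\<close>

definition decided :: "('a \<Rightarrow> bool) \<Rightarrow> 'a filter \<Rightarrow> bool" where
  "decided P F \<longleftrightarrow> eventually P F \<or> eventually (\<lambda>x. \<not> P x) F"

lemma decided_conj:
  assumes "decided P F" "decided Q F"
  shows "decided (\<lambda>x. P x \<and> Q x) F"
proof -
  consider "eventually P F" "eventually Q F" | "\<forall>\<^sub>F x in F. \<not> P x" | "\<forall>\<^sub>F x in F. \<not> Q x"
    using assms by (auto simp: decided_def)
  then show ?thesis
  proof cases
    case 1
    then show ?thesis by (simp add: decided_def eventually_conj)
  next
    case 2
    then have "\<forall>\<^sub>F x in F. \<not> (P x \<and> Q x)" by eventually_elim simp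
    then show ?thesis by (simp add: decided_def)
  next
    case 3
    then have "\<forall>\<^sub>F x in F. \<not> (P x \<and> Q x)" by eventually_elim simp
    then show ?thesis by (simp add: decided_def)
  qed
qed

lemma decided_ball_finite:
  assumes "finite A" "\<And>a. a \<in> A \<Longrightarrow> decided (P a) F"
  shows "decided (\<lambda>x. \<forall>a\<in>A. P a x) F"
  using assms
proof (induction rule: finite_induct)
  case empty
  then show ?case by (simp add: decided_def)
next
  case (insert a A)
  then show ?case using decided_conj[of "P a" F "\<lambda>x. \<forall>a\<in>A. P a x"] by simp
qed

lemma decided_eventually_iff:
  assumes "decided P F" "F \<noteq> bot"
  shows "\<forall>\<^sub>F x in F. P x \<longleftrightarrow> eventually P F"
proof (cases "eventually P F")
  case True
  then show ?thesis by (auto elim: eventually_mono)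
next
  case False
  then show ?thesis using assms by (auto simp: decided_def)
qed

lemma decided_affine:
  fixes a b :: real
  assumes "b \<noteq> 0"
  shows "decided (\<lambda>e. 0 < a + e * b) (at_right 0)"
proof -
  have t: "((\<lambda>e. a + e * b) \<longlongrightarrow> a + 0 * b) (at_right 0)" by (intro tendsto_intros)
  have pos: "\<forall>\<^sub>F e in at_right 0. 0 < (e::real)" by (rule eventually_at_right_less)
  \<comment> \<open>Nonzero \<open>a\<close> is decided by continuity; for \<open>a\<close> = 0 the
    sign of \<open>b\<close> decides, which needs the one-sided filter.\<close>
  consider "0 < a" | "a < 0" | "a = 0" "0 < b" | "a = 0" "b < 0" using assms by linarith
  then show ?thesis
  proof cases
    case 1
    then show ?thesis using order_tendstoD(1)[OF t] by (simp add: decided_def)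
  next
    case 2
    then have "\<forall>\<^sub>F e in at_right 0. a + e * b < 0" using order_tendstoD(2)[OF t, of 0] by simp
    then have "\<forall>\<^sub>F e in at_right 0. \<not> 0 < a + e * b" by eventually_elim simp
    then show ?thesis by (simp add: decided_def)
  next
    case 3
    then show ?thesis using pos by (auto simp: decided_def elim!: eventually_mono)
  next
    case 4
    have "\<forall>\<^sub>F e in at_right 0. \<not> 0 < a + e * b"
      using pos by eventually_elim (use 4 in \<open>simp add: zero_less_mult_iff\<close>)
    then show ?thesis by (simp add: decided_def)
  qed
qed

text \<open>Each coordinate of q + e w is affine in \<open>e\<close>, with nonzero slope because
  \<open>w\<close> avoids the span of the other r - 1 vectors.\<close>

lemma decided_in_box:
  fixes f :: "'i \<Rightarrow> real ^ 'r::finite"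
  assumes I: "finite I" "card I = CARD('r)"
    and gen: "\<And>B. span (f ` B) \<noteq> UNIV \<Longrightarrow> w \<notin> span (f ` B)"
  shows "decided (\<lambda>e. in_box f I (q + e *\<^sub>R w)) (at_right 0)"
proof (cases "span (f ` I) = UNIV")
  case False
  then show ?thesis by (simp add: in_box_def decided_def)
next
  case True
  obtain L where L: "is_coordinates f I L" using obtain_coordinates[OF I True] by blast
  have nz: "L i w \<noteq> 0" if i: "i \<in> I" for i
  proof
    assume "L i w = 0"
    then have "w = (\<Sum>k\<in>I - {i}. L k w *\<^sub>R f k)"
      using is_coordinatesD(2)[OF L, of w] I i by (simp add: sum.remove)
    also have "\<dots> \<in> span (f ` (I - {i}))"
      by (auto intro!: span_sum span_scale intro: span_base)
    finally have "span (f ` (I - {i})) = UNIV" using gen by blast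
    moreover have "card (I - {i}) < CARD('r)" using I i by (metis card_Diff1_less)
    ultimately show False using span_small_not_UNIV I(1) by blast
  qed
  have aff: "L i (q + e *\<^sub>R w) = L i q + e * L i w" for i e
    using is_coordinatesD(1)[OF L, of i] by (simp add: linear_add linear_cmul)
  have "decided (\<lambda>e. \<forall>i\<in>I. 0 < L i q + e * L i w \<and> L i q + e * L i w < 1) (at_right 0)"
  proof (intro decided_ball_finite decided_conj I(1))
    fix i assume i: "i \<in> I"
    show "decided (\<lambda>e. 0 < L i q + e * L i w) (at_right 0)"
      by (rule decided_affine) (rule nz[OF i])
    have "decided (\<lambda>e. 0 < (1 - L i q) + e * (- L i w)) (at_right 0)"
      by (rule decided_affine) (simp add: nz[OF i])
    then show "decided (\<lambda>e. L i q + e * L i w < 1) (at_right 0)"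
      by (simp add: algebra_simps)
  qed
  then show ?thesis unfolding in_box_coordinates[OF I True L] aff .
qed

text \<open>Two parameters with points in \<open>S\<close> would put a nonzero multiple of
  \<open>w\<close> into \<open>S\<close>, so at most one parameter has to be avoided.\<close>

lemma eventually_line_notin_subspace:
  fixes w :: "'a::real_vector"
  assumes "subspace S" "w \<notin> S"
  shows "\<forall>\<^sub>F e in at_right 0. q + e *\<^sub>R w \<notin> S"
proof (cases "\<exists>e. q + e *\<^sub>R w \<in> S")
  case True
  then obtain e0 where e0: "q + e0 *\<^sub>R w \<in> S" by blast
  have "q + e *\<^sub>R w \<notin> S" if "e \<noteq> e0" for e
  proof
    assume "q + e *\<^sub>R w \<in> S"
    from subspace_diff[OF assms(1) this e0] have "(e - e0) *\<^sub>R w \<in> S" by (simp add: algebra_simps)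
    from subspace_scale[OF assms(1) this, of "1 / (e - e0)"]
    show False using that assms(2) by simp
  qed
  moreover have "\<forall>\<^sub>F e in at_right 0. e \<noteq> e0" by (rule eventually_neq_at_within)
  ultimately show ?thesis by (auto elim: eventually_mono)
qed simp

lemma eventually_general_position:
  fixes f :: "'i::finite \<Rightarrow> 'a::real_vector"
  assumes gen: "\<And>B. span (f ` B) \<noteq> UNIV \<Longrightarrow> w \<notin> span (f ` B)"
  shows "\<forall>\<^sub>F e in at_right 0. general_position f (q + e *\<^sub>R w)"
  unfolding general_position_def
proof (intro eventually_all_finite eventually_ball_finite ballI)
  fix i k :: 'i and B :: "'i set" and s s' :: real
  show "\<forall>\<^sub>F e in at_right 0. span (f ` B) \<noteq> UNIV \<longrightarrow>
      q + e *\<^sub>R w - s *\<^sub>R f k - s' *\<^sub>R f i \<notin> span (f ` B)"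
  proof (cases "span (f ` B) = UNIV")
    case False
    then show ?thesis
      using eventually_line_notin_subspace[OF subspace_span gen[OF False], of "q - s *\<^sub>R f k - s' *\<^sub>R f i"]
      by (simp add: algebra_simps)
  qed simp
qed simp_all

section \<open>Lattice functionals and determinants\<close>

lemma to_real_add: "to_real (a + b) = to_real a + to_real b"
  and to_real_diff: "to_real (a - b) = to_real a - to_real b"
  and to_real_0: "to_real 0 = 0"
  by (simp_all add: to_real_def vec_eq_iff)

lemma to_real_sum: "to_real (\<Sum>i\<in>I. g i) = (\<Sum>i\<in>I. to_real (g i))"
  by (induction I rule: infinite_finite_induct) (simp_all add: to_real_0 to_real_add)

lemma inj_to_real: "inj to_real"
  by (auto simp: inj_def to_real_def vec_eq_iff)

lemma dual_lattice_scale: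
  assumes "\<mu> \<in> dual_lattice"
  shows "\<mu> (k *s a) = k * \<mu> a"
proof -
  interpret additive \<mu> using assms by unfold_locales (auto simp: dual_lattice_def)
  have nat: "\<mu> (of_nat n *s a) = of_nat n * \<mu> a" for n
    by (induction n) (simp_all add: zero add vector_sadd_rdistrib algebra_simps)
  show ?thesis
  proof (cases "0 \<le> k")
    case True
    then show ?thesis using nat[of "Int.nat k"] by simp
  next
    case False
    then have "\<mu> (- (k *s a)) = - (k * \<mu> a)" using nat[of "Int.nat (- k)"]
      by (simp add: vector_sneg_minus1)
    then show ?thesis by (simp add: minus)
  qed
qed

text \<open>The differential equations use integral functionals, whereas the linear relation among
  the vectors of \<open>K\<close> has real coefficients; this connects the two.\<close>

lemma dual_lattice_extend:
  fixes \<mu> :: "int ^ 'r::finite \<Rightarrow> int"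
  assumes "\<mu> \<in> dual_lattice"
  obtains m :: "real ^ 'r \<Rightarrow> real" where "linear m" "\<And>x. m (to_real x) = of_int (\<mu> x)"
proof
  interpret additive \<mu> using assms by unfold_locales (auto simp: dual_lattice_def)
  define m where "m y = (\<Sum>j\<in>UNIV. of_int (\<mu> (axis j 1)) * y $ j)" for y :: "real ^ 'r"
  show "linear m"
    by (intro linearI) (simp_all add: m_def algebra_simps sum.distrib sum_distrib_left)
  show "m (to_real x) = of_int (\<mu> x)" for x
  proof -
    have "\<mu> x = \<mu> (\<Sum>j\<in>UNIV. (x $ j) *s axis j 1)" by (simp add: basis_expansion)
    also have "\<dots> = (\<Sum>j\<in>UNIV. x $ j * \<mu> (axis j 1))"
      by (simp add: sum dual_lattice_scale[OF assms])
    finally show ?thesis by (simp add: m_def to_real_def mult.commute)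
  qed
qed

text \<open>Two listings of \<open>I\<close> differ by a permutation of the rows, so the arbitrary
  choice in \<open>Vol\<close> affects only the sign.\<close>

lemma Vol_eq_abs_det:
  fixes v :: "'n \<Rightarrow> int ^ 'r::finite"
  assumes e: "bij_betw e UNIV I"
  shows "Vol v I = \<bar>det (\<chi> k. v (e k))\<bar>"
proof -
  define e' where "e' = (SOME e :: 'r \<Rightarrow> 'n. bij_betw e UNIV I)"
  have e': "bij_betw e' UNIV I" unfolding e'_def using e by (rule someI[of "\<lambda>e. bij_betw e UNIV I"])
  define p where "p = inv_into UNIV e \<circ> e'"
  have "bij_betw p UNIV UNIV"
    unfolding p_def by (rule bij_betw_trans[OF e' bij_betw_inv_into[OF e]])
  then have p: "p permutes UNIV" by (rule bij_imp_permutes) simp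
  have ep: "e (p k) = e' k" for k
    using e e' by (auto simp: p_def bij_betw_def intro!: f_inv_into_f)
  have "det (\<chi> k. v (e' k)) = of_int (sign p) * det (\<chi> k. v (e k))"
    using det_permute_rows[OF p, of "\<chi> k. v (e k)"] by (simp add: ep)
  then have "\<bar>det (\<chi> k. v (e' k))\<bar> = \<bar>det (\<chi> k. v (e k))\<bar>"
    by (simp add: abs_mult sign_def)
  then show ?thesis by (simp add: Vol_def Let_def e'_def)
qed

lemma Vol_nonneg: "0 \<le> Vol v I"
  by (simp add: Vol_def Let_def)

text \<open>Let the row of \<open>v j\<close> in the determinant vary: another member of
  \<open>I\<close> repeats a row, and an outside \<open>v i\<close> gives the determinant of the
  exchanged set.\<close>

lemma exists_cofactor_functional:
  fixes v :: "'n::finite \<Rightarrow> int ^ 'r::finite"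
  assumes I: "card I = CARD('r)" "j \<in> I"
  shows "\<exists>\<mu>\<in>dual_lattice. \<mu> (v j) = Vol v I \<and> (\<forall>i\<in>I - {j}. \<mu> (v i) = 0) \<and>
     (\<forall>i. i \<notin> I \<longrightarrow> \<bar>\<mu> (v i)\<bar> = Vol v (insert i (I - {j})))"
proof -
  obtain e :: "'r \<Rightarrow> 'n" where e: "bij_betw e UNIV I"
    using finite_same_card_bij[of "UNIV :: 'r set" I] I by auto
  then obtain k where k: "e k = j" using I(2) by (auto simp: bij_betw_def)
  define D where "D x = det (\<chi> l. if l = k then x else v (e l))" for x
  \<comment> \<open>This normalises the value at \<open>v j\<close> to be nonnegative. Choosing 1
    for a zero determinant keeps \<open>s\<close> a unit, so the absolute values outside
    \<open>I\<close> are right for degenerate \<open>I\<close> too.\<close>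
  define s where "s = (if det (\<chi> l. v (e l)) < 0 then - 1 else 1 :: int)"
  define \<mu> where "\<mu> x = s * D x" for x
  have Dupd: "D (v i) = det (\<chi> l. v ((e(k := i)) l))" for i
    unfolding D_def by (rule arg_cong[of _ _ det]) (simp add: vec_eq_iff)
  have "D (a + b) = D a + D b" for a b
    using det_row_add[of k "\<lambda>_. a" "\<lambda>_. b" "\<lambda>l. v (e l)"] by (simp add: D_def)
  then have "\<mu> \<in> dual_lattice" by (simp add: dual_lattice_def \<mu>_def algebra_simps)
  moreover have "\<mu> (v j) = Vol v I"
    using Dupd[of j] k by (simp add: \<mu>_def s_def Vol_eq_abs_det[OF e] fun_upd_idem)
  moreover have "\<mu> (v i) = 0" if i: "i \<in> I - {j}" for i
  proof -
    obtain l where l: "e l = i" using i e by (auto simp: bij_betw_def)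
    then have "l \<noteq> k" using i k by auto
    then have "D (v i) = 0"
      unfolding D_def using l by (intro det_identical_rows[of k l]) (auto simp: row_def)
    then show ?thesis by (simp add: \<mu>_def)
  qed
  moreover have "\<bar>\<mu> (v i)\<bar> = Vol v (insert i (I - {j}))" if i: "i \<notin> I" for i
  proof -
    have "inj (e(k := i))"
      using e i by (auto simp: inj_on_fun_updI bij_betw_def)
    moreover have "range (e(k := i)) = insert i (I - {j})"
      using e k by (auto simp: bij_betw_def inj_def image_iff split: if_splits)
    ultimately have "bij_betw (e(k := i)) UNIV (insert i (I - {j}))" by (simp add: bij_betw_def)
    from Vol_eq_abs_det[OF this] show ?thesis by (simp add: \<mu>_def s_def abs_mult Dupd)
  qed
  ultimately show ?thesis by blast
qed

section \<open>Cones\<close>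

text \<open>Gives access to the theory of convex cone hulls, in particular to the closedness of
  finitely generated cones.\<close>

lemma generated_cone_eq_hull:
  fixes f :: "'i \<Rightarrow> real ^ 'r::finite"
  assumes "finite S"
  shows "generated_cone f S = convex_cone hull (f ` S)"
proof (rule antisym)
  let ?H = "convex_cone hull (f ` S)"
  have H: "convex_cone ?H" by (rule convex_cone_convex_cone_hull)
  have "(\<Sum>i\<in>T. a i *\<^sub>R f i) \<in> ?H" if "T \<subseteq> S" "\<forall>i\<in>S. 0 \<le> a i" for T a
    using finite_subset[OF that(1) assms] that(1)
  proof (induction T rule: finite_induct)
    case empty
    then show ?case by (simp add: convex_cone_hull_contains_0)
  next
    case (insert i T)
    then have "a i *\<^sub>R f i \<in> ?H"
      using that(2) by (intro convex_cone_scaleR[OF H]) (auto intro: hull_inc)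
    then show ?case using insert by (simp add: convex_cone_add[OF H])
  qed
  then show "generated_cone f S \<subseteq> ?H" by (auto simp: generated_cone_def)
  show "?H \<subseteq> generated_cone f S"
  proof (rule hull_minimal)
    show "f ` S \<subseteq> generated_cone f S"
    proof (intro image_subsetI)
      fix i assume i: "i \<in> S"
      have "f i = (\<Sum>k\<in>S. (if k = i then 1 else 0) *\<^sub>R f k)"
        using i assms by (simp add: if_distrib[of "\<lambda>c. c *\<^sub>R _"] cong: if_cong)
      then show "f i \<in> generated_cone f S"
        unfolding generated_cone_def by (intro CollectI exI[of _ "\<lambda>k. if k = i then 1 else 0"]) simp
    qed
    show "convex_cone (generated_cone f S)"
      unfolding convex_cone_iff
    proof (intro conjI ballI allI impI)
      show "0 \<in> generated_cone f S"
        unfolding generated_cone_def by (intro CollectI exI[of _ "\<lambda>_. 0"]) simp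
    next
      fix x y assume "x \<in> generated_cone f S" "y \<in> generated_cone f S"
      then obtain a b where "x = (\<Sum>i\<in>S. a i *\<^sub>R f i)" "\<forall>i\<in>S. 0 \<le> a i"
        "y = (\<Sum>i\<in>S. b i *\<^sub>R f i)" "\<forall>i\<in>S. 0 \<le> b i"
        by (auto simp: generated_cone_def)
      then show "x + y \<in> generated_cone f S"
        unfolding generated_cone_def
        by (intro CollectI exI[of _ "\<lambda>i. a i + b i"]) (simp add: scaleR_add_left sum.distrib)
    next
      fix x and t :: real assume "x \<in> generated_cone f S" "0 \<le> t"
      then obtain a where "x = (\<Sum>i\<in>S. a i *\<^sub>R f i)" "\<forall>i\<in>S. 0 \<le> a i" "0 \<le> t"
        by (auto simp: generated_cone_def)
      then show "t *\<^sub>R x \<in> generated_cone f S"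
        unfolding generated_cone_def
        by (intro CollectI exI[of _ "\<lambda>i. t * a i"]) (simp add: scaleR_sum_right)
    qed
  qed
qed

lemma span_generated_cone:
  fixes f :: "'i \<Rightarrow> real ^ 'r::finite"
  assumes "finite S"
  shows "span (generated_cone f S) = span (f ` S)"
proof (rule antisym)
  have "generated_cone f S \<subseteq> span (f ` S)"
    by (auto simp: generated_cone_def intro!: span_sum span_scale intro: span_base)
  then show "span (generated_cone f S) \<subseteq> span (f ` S)" by (simp add: span_minimal)
  show "span (f ` S) \<subseteq> span (generated_cone f S)"
    unfolding generated_cone_eq_hull[OF assms] by (intro span_mono hull_subset)
qed

lemma rational_polyhedral_cone_closed:
  assumes "rational_polyhedral_cone C"
  shows "closed C" "convex_cone C"
proof -
  obtain G where "finite G" "C = generated_cone to_real G"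
    using assms by (auto simp: rational_polyhedral_cone_def)
  then show "closed C" "convex_cone C"
    by (simp_all add: generated_cone_eq_hull convex_cone_convex_cone_hull
        polyhedron_imp_closed polyhedron_convex_cone_hull)
qed

lemma convex_cone_add_interior:
  fixes C :: "'a::real_normed_vector set"
  assumes "convex_cone C" "a \<in> C" "b \<in> interior C"
  shows "a + b \<in> interior C"
proof -
  have "(+) a ` interior C \<subseteq> interior C"
  proof (rule interior_maximal)
    show "(+) a ` interior C \<subseteq> C"
      using convex_cone_add[OF assms(1,2)] interior_subset by blast
    show "open ((+) a ` interior C)" by (intro open_translation open_interior)
  qed
  then show ?thesis using assms(3) by blast
qed

lemma convex_cone_scale_interior:
  fixes C :: "'a::real_normed_vector set"
  assumes "convex_cone C" "0 < t" "b \<in> interior C"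
  shows "t *\<^sub>R b \<in> interior C"
proof -
  have "(\<lambda>x. t *\<^sub>R x) ` interior C \<subseteq> interior C"
  proof (rule interior_maximal)
    show "(\<lambda>x. t *\<^sub>R x) ` interior C \<subseteq> C"
      using convex_cone_scaleR[OF assms(1), of t] assms(2) interior_subset by fastforce
    show "open ((\<lambda>x. t *\<^sub>R x) ` interior C)"
      using assms(2) by (intro open_scaling) auto
  qed
  then show ?thesis using assms(3) by blast
qed

text \<open>In an unbounded slice, normalising a sequence c n of growing norm gives a unit limit
  \<open>l\<close> in \<open>C\<close>. The vectors b - c n, scaled by the same factors, tend to -
  l, which is then in \<open>C\<close> as well, against pointedness.\<close>

lemma bounded_cone_slice:
  fixes C :: "'a::euclidean_space set"
  assumes "closed C" "convex_cone C" "C \<inter> uminus ` C = {0}"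
  shows "bounded {c \<in> C. b - c \<in> C}"
proof (rule ccontr)
  assume "\<not> bounded {c \<in> C. b - c \<in> C}"
  then have "\<exists>c. (c \<in> C \<and> b - c \<in> C) \<and> real n < norm c" for n :: nat
    unfolding bounded_iff by (auto simp: not_le)
  then obtain c where c: "\<And>n. c n \<in> C" "\<And>n. b - c n \<in> C" "\<And>n. real n < norm (c n)" by metis
  have pos: "0 < norm (c n)" for n using c(3)[of n] of_nat_0_le_iff[of n, where ?'a = real] by linarith
  define y where "y n = inverse (norm (c n)) *\<^sub>R c n" for n
  have "\<forall>n. y n \<in> sphere 0 1" using pos by (simp add: y_def)
  then obtain l \<phi> where l: "l \<in> sphere 0 1" "strict_mono \<phi>" "(y \<circ> \<phi>) \<longlonglongrightarrow> l"
    using compact_sphere[of 0 1] unfolding compact_def by metis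
  have inf: "filterlim (\<lambda>n. norm (c (\<phi> n))) at_top sequentially"
  proof (rule filterlim_at_top_mono[OF filterlim_real_sequentially])
    show "\<forall>\<^sub>F n in sequentially. real n \<le> norm (c (\<phi> n))"
    proof (intro always_eventually allI)
      fix n
      have "real n \<le> real (\<phi> n)" using seq_suble[OF l(2)] by simp
      then show "real n \<le> norm (c (\<phi> n))" using c(3)[of "\<phi> n"] by linarith
    qed
  qed
  have "y n \<in> C" for n
    using pos[of n] c(1) by (simp add: y_def convex_cone_scaleR[OF assms(2)])
  then have "l \<in> C" using closed_sequentially[OF assms(1) _ l(3)] by simp
  moreover have "- l \<in> C"
  proof -
    have "(\<lambda>n. inverse (norm (c (\<phi> n))) *\<^sub>R b - (y \<circ> \<phi>) n) \<longlonglongrightarrow> 0 *\<^sub>R b - l"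
      by (intro tendsto_intros l(3) tendsto_inverse_0_at_top[OF inf])
    moreover have "inverse (norm (c (\<phi> n))) *\<^sub>R b - (y \<circ> \<phi>) n \<in> C" for n
    proof -
      have "inverse (norm (c (\<phi> n))) *\<^sub>R (b - c (\<phi> n)) \<in> C"
        using pos[of "\<phi> n"] c(2) by (simp add: convex_cone_scaleR[OF assms(2)])
      then show ?thesis by (simp add: y_def algebra_simps)
    qed
    ultimately show ?thesis using closed_sequentially[OF assms(1)] by fastforce
  qed
  ultimately have "l \<in> C \<inter> uminus ` C" by force
  then show False using assms(3) l(1) by auto
qed

lemma finite_lattice_points_bounded:
  assumes "bounded (S :: (real ^ 'r::finite) set)"
  shows "finite (cone_points S)"
proof -
  obtain B where B: "\<And>x. x \<in> S \<Longrightarrow> norm x \<le> B" using assms by (auto simp: bounded_iff)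
  have "cone_points S \<subseteq> {c. \<forall>j. c $ j \<in> {- \<lceil>B\<rceil>..\<lceil>B\<rceil>}}"
  proof (intro subsetI CollectI allI)
    fix c :: "int ^ 'r" and j assume "c \<in> cone_points S"
    then have "\<bar>to_real c $ j\<bar> \<le> B"
      using B component_le_norm_cart[of "to_real c" j] by (force simp: cone_points_def)
    then show "c $ j \<in> {- \<lceil>B\<rceil>..\<lceil>B\<rceil>}" by (simp add: to_real_def) linarith
  qed
  moreover have "finite {c :: int ^ 'r. \<forall>j. c $ j \<in> {- \<lceil>B\<rceil>..\<lceil>B\<rceil>}}"
  proof (rule finite_imageD)
    show "inj_on vec_nth {c :: int ^ 'r. \<forall>j. c $ j \<in> {- \<lceil>B\<rceil>..\<lceil>B\<rceil>}}"
      by (simp add: inj_on_def vec_nth_inject)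
    have "vec_nth ` {c :: int ^ 'r. \<forall>j. c $ j \<in> {- \<lceil>B\<rceil>..\<lceil>B\<rceil>}} \<subseteq> (\<Pi>\<^sub>E j\<in>UNIV. {- \<lceil>B\<rceil>..\<lceil>B\<rceil>})"
      by auto
    then show "finite (vec_nth ` {c :: int ^ 'r. \<forall>j. c $ j \<in> {- \<lceil>B\<rceil>..\<lceil>B\<rceil>}})"
      by (rule finite_subset) (intro finite_PiE finite; simp)
  qed
  ultimately show ?thesis by (rule finite_subset)
qed

text \<open>For each of the finitely many \<open>I\<close>, the point \<open>c\<close> is a lattice
  point of a bounded slice, and \<open>c\<close> determines \<open>d\<close>.\<close>

lemma finite_pairing_index:
  fixes v :: "'n::finite \<Rightarrow> int ^ 'r::finite"
  assumes "rational_polyhedral_cone C"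
  shows "finite (pairing_index C v)"
proof -
  note C = rational_polyhedral_cone_closed[OF assms]
  define S where "S I = {c \<in> C. to_real (\<Sum>i\<in>I. v i) - c \<in> C}" for I
  have "finite (cone_points (S I))" for I
    unfolding S_def using assms
    by (intro finite_lattice_points_bounded bounded_cone_slice C) (simp add: rational_polyhedral_cone_def)
  then have "finite (\<Union>I. (\<lambda>c. (c, (\<Sum>i\<in>I. v i) - c, I)) ` cone_points (S I))" by simp
  moreover have "pairing_index C v \<subseteq> (\<Union>I. (\<lambda>c. (c, (\<Sum>i\<in>I. v i) - c, I)) ` cone_points (S I))"
  proof
    fix t assume "t \<in> pairing_index C v"
    then obtain c d I where t: "t = (c, d, I)" "c \<in> cone_points C" "d \<in> cone_points (interior C)"
      "c + d = (\<Sum>i\<in>I. v i)" by (auto simp: pairing_index_def)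
    then have d: "d = (\<Sum>i\<in>I. v i) - c" by (simp add: algebra_simps)
    then have "c \<in> cone_points (S I)"
      using t interior_subset[of C] by (auto simp: S_def cone_points_def to_real_diff)
    then show "t \<in> (\<Union>I. (\<lambda>c. (c, (\<Sum>i\<in>I. v i) - c, I)) ` cone_points (S I))"
      using t(1) d by blast
  qed
  ultimately show ?thesis by (rule finite_subset[rotated])
qed

section \<open>Coefficients of the pairing\<close>

text \<open>The number \<open>xi\<close> with \<open>d\<close> eliminated. It makes sense for every
  lattice point \<open>c\<close>, without cone conditions, so that shifts of \<open>c\<close> by
  \<open>v k\<close> are unrestricted.\<close>

definition weight :: "(int ^ 'r \<Rightarrow> int) \<Rightarrow> ('n \<Rightarrow> int ^ 'r) \<Rightarrow> real ^ 'r \<Rightarrow> int ^ 'r \<Rightarrow> 'n set \<Rightarrow> complex" where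
  "weight deg v w c I =
     (if \<forall>\<^sub>F \<epsilon> in at_right 0. in_box (\<lambda>i. to_real (v i)) I (to_real c + \<epsilon> *\<^sub>R w)
      then (-1) powi deg c else 0)"

lemma xi_eq_weight:
  fixes v :: "'n::finite \<Rightarrow> int ^ 'r::finite"
  assumes "c + d = (\<Sum>i\<in>I. v i)"
  shows "xi deg v w c d I = weight deg v w c I"
proof -
  have full: "dim (sigma v I) = CARD('r) \<longleftrightarrow> span ((\<lambda>i. to_real (v i)) ` I) = UNIV"
    using dim_eq_full[of "sigma v I"] by (simp add: sigma_def span_generated_cone)
  have "to_real c + to_real d = (\<Sum>i\<in>I. to_real (v i))"
    using arg_cong[OF assms, of to_real] by (simp add: to_real_add to_real_sum)
  then have d: "to_real d - e *\<^sub>R w = (\<Sum>i\<in>I. to_real (v i)) - (to_real c + e *\<^sub>R w)" for e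
    by (simp add: algebra_simps)
  show ?thesis
    unfolding xi_def weight_def full
    unfolding in_box_def sigma_def d by (simp add: eventually_conj_iff)
qed

text \<open>As eps tends to 0, c + eps w stays in the closed cone \<open>C\<close>, hence
  \<open>c\<close> is in \<open>C\<close>; and d = (d - eps w) + eps w lies in \<open>C\<close> plus
  its interior. So both systems of equations are available wherever a coefficient is
  nonzero.\<close>

lemma weight_nonzero_imp_cone:
  fixes v :: "'n::finite \<Rightarrow> int ^ 'r::finite"
  assumes C: "rational_polyhedral_cone C" and v: "\<And>i. to_real (v i) \<in> C" and w: "w \<in> interior C"
    and nz: "weight deg v w c I \<noteq> 0"
  shows "c \<in> cone_points C" "(\<Sum>i\<in>I. v i) - c \<in> cone_points (interior C)"
proof -
  note C = rational_polyhedral_cone_closed[OF C]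
  let ?f = "\<lambda>i. to_real (v i)"
  have "convex_cone hull (?f ` I) \<subseteq> C" using C(2) v by (intro hull_minimal) auto
  then have sub: "interior (generated_cone ?f I) \<subseteq> C"
    using interior_subset generated_cone_eq_hull[of I ?f] by auto
  have ev: "\<forall>\<^sub>F e in at_right 0. in_box ?f I (to_real c + e *\<^sub>R w)"
    using nz by (auto simp: weight_def split: if_splits)
  then have "\<forall>\<^sub>F e in at_right 0. to_real c + e *\<^sub>R w \<in> C"
    by eventually_elim (use sub in \<open>auto simp: in_box_def\<close>)
  moreover have "((\<lambda>e. to_real c + e *\<^sub>R w) \<longlongrightarrow> to_real c + 0 *\<^sub>R w) (at_right 0)"
    by (intro tendsto_intros)
  ultimately have "to_real c + 0 *\<^sub>R w \<in> C"
    by (intro Lim_in_closed_set[OF C(1)]) auto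
  then show "c \<in> cone_points C" by (simp add: cone_points_def)
  have "\<forall>\<^sub>F e in at_right 0. 0 < e \<and> in_box ?f I (to_real c + e *\<^sub>R w)"
    using ev eventually_at_right_less by (rule eventually_conj[rotated])
  from eventually_happens'[OF trivial_limit_at_right_real this]
  obtain e where e: "0 < e" "in_box ?f I (to_real c + e *\<^sub>R w)" by blast
  then have "(\<Sum>i\<in>I. ?f i) - (to_real c + e *\<^sub>R w) \<in> C" using sub by (auto simp: in_box_def)
  then have "((\<Sum>i\<in>I. ?f i) - (to_real c + e *\<^sub>R w)) + e *\<^sub>R w \<in> interior C"
    using e(1) w C(2) by (intro convex_cone_add_interior convex_cone_scale_interior)
  then show "(\<Sum>i\<in>I. v i) - c \<in> cone_points (interior C)"
    by (simp add: cone_points_def to_real_diff to_real_sum)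
qed

text \<open>The sign (-1)^deg c flips between \<open>c\<close> and \<open>c - v k\<close>, so each
  sum of two weights is a common sign times a difference of box indicators. The rest is
  \<open>signed_box_relation\<close> at c + eps w.\<close>

lemma weight_relation:
  fixes v :: "'n::finite \<Rightarrow> int ^ 'r::finite"
  assumes deg: "deg \<in> dual_lattice" "\<And>i. deg (v i) = 1"
    and v: "inj v" and w: "generic v w"
    and K: "card K = Suc CARD('r)" "j \<in> K"
    and \<mu>: "\<And>k. k \<in> K - {j} \<Longrightarrow> \<mu> k \<in> dual_lattice" "\<And>k. k \<in> K - {j} \<Longrightarrow> \<mu> k (v j) = Vol v (K - {k})"
      "\<And>k i. k \<in> K - {j} \<Longrightarrow> i \<in> K - {k, j} \<Longrightarrow> \<mu> k (v i) = 0"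
      "\<And>k. k \<in> K - {j} \<Longrightarrow> \<bar>\<mu> k (v k)\<bar> = Vol v (K - {j})"
  shows "of_int (Vol v (K - {j})) * (weight deg v w c (K - {j}) + weight deg v w (c - v j) (K - {j}))
    = (\<Sum>k\<in>K - {j}. of_int (\<mu> k (v k)) * (weight deg v w c (K - {k}) + weight deg v w (c - v k) (K - {k})))"
proof -
  let ?f = "\<lambda>i. to_real (v i)"
  have gen: "\<And>B. span (?f ` B) \<noteq> UNIV \<Longrightarrow> w \<notin> span (?f ` B)"
    using w by (auto simp: generic_def)
  define ev where "ev c k \<longleftrightarrow> (\<forall>\<^sub>F e in at_right 0. in_box ?f (K - {k}) (to_real c + e *\<^sub>R w))" for c k
  have dec: "\<forall>\<^sub>F e in at_right 0. in_box ?f (K - {k}) (to_real c + e *\<^sub>R w) \<longleftrightarrow> ev c k" if "k \<in> K" for k c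
    unfolding ev_def using that K gen
    by (intro decided_eventually_iff decided_in_box) auto
  \<comment> \<open>Finitely many eventual conditions are collected, so that one \<open>e\<close>
    puts the point in general position and gives all boxes their limiting truth values.\<close>
  have "\<forall>\<^sub>F e in at_right 0. general_position ?f (to_real c + e *\<^sub>R w) \<and>
      (\<forall>k\<in>K. (in_box ?f (K - {k}) (to_real c + e *\<^sub>R w) \<longleftrightarrow> ev c k) \<and>
             (in_box ?f (K - {k}) (to_real (c - v k) + e *\<^sub>R w) \<longleftrightarrow> ev (c - v k) k))"
    by (intro eventually_conj eventually_general_position gen eventually_ball_finite ballI dec) auto
  from eventually_happens'[OF trivial_limit_at_right_real this]
  obtain e where e': "general_position ?f (to_real c + e *\<^sub>R w) \<and>
      (\<forall>k\<in>K. (in_box ?f (K - {k}) (to_real c + e *\<^sub>R w) \<longleftrightarrow> ev c k) \<and>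
             (in_box ?f (K - {k}) (to_real (c - v k) + e *\<^sub>R w) \<longleftrightarrow> ev (c - v k) k))" by blast
  then have e: "general_position ?f (to_real c + e *\<^sub>R w)"
    "\<And>k. k \<in> K \<Longrightarrow> in_box ?f (K - {k}) (to_real c + e *\<^sub>R w) \<longleftrightarrow> ev c k"
    "\<And>k. k \<in> K \<Longrightarrow> in_box ?f (K - {k}) (to_real (c - v k) + e *\<^sub>R w) \<longleftrightarrow> ev (c - v k) k"
    by simp_all
  define p where "p = to_real c + e *\<^sub>R w"
  define \<tau> :: "'n \<Rightarrow> real"
    where "\<tau> k = of_bool (in_box ?f (K - {k}) p) - of_bool (in_box ?f (K - {k}) (p - ?f k))" for k
  have pk: "p - ?f k = to_real (c - v k) + e *\<^sub>R w" for k by (simp add: p_def to_real_diff)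
  interpret deg: additive deg using deg by unfold_locales (auto simp: dual_lattice_def)
  have weights: "weight deg v w c (K - {k}) + weight deg v w (c - v k) (K - {k})
      = (-1) powi deg c * of_real (\<tau> k)" if "k \<in> K" for k
  proof -
    have "(-1 :: complex) powi deg (c - v k) = - ((-1) powi deg c)"
      using deg by (simp add: deg.diff power_int_diff)
    then show ?thesis
      using e(2,3)[OF that] unfolding \<tau>_def pk by (simp add: weight_def p_def flip: ev_def)
  qed
  have "\<forall>k. \<exists>m. k \<in> K - {j} \<longrightarrow> linear m \<and> (\<forall>x. m (to_real x) = real_of_int (\<mu> k x))"
    using dual_lattice_extend[OF \<mu>(1)] by metis
  then obtain m where m: "\<And>k. k \<in> K - {j} \<Longrightarrow> linear (m k)"
    "\<And>k x. k \<in> K - {j} \<Longrightarrow> m k (to_real x) = real_of_int (\<mu> k x)" by metis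
  have "real_of_int (Vol v (K - {j})) * \<tau> j = (\<Sum>k\<in>K - {j}. m k (?f k) * \<tau> k)"
    unfolding \<tau>_def
  proof (rule signed_box_relation[where vol = "\<lambda>k. real_of_int (Vol v (K - {k}))"])
    show "inj_on ?f K" using v inj_to_real by (auto simp: inj_on_def inj_def)
    show "\<bar>m k (?f k)\<bar> = real_of_int (Vol v (K - {j}))" if "k \<in> K - {j}" for k
      using \<mu>(4)[OF that] m(2)[OF that] by (metis of_int_abs)
  qed (use K m \<mu> e(1) Vol_nonneg[of v] in \<open>auto simp: p_def\<close>)
  then have "complex_of_real (real_of_int (Vol v (K - {j})) * \<tau> j) = of_real (\<Sum>k\<in>K - {j}. m k (?f k) * \<tau> k)"
    by (rule arg_cong)
  also have "\<dots> = (\<Sum>k\<in>K - {j}. of_int (\<mu> k (v k)) * of_real (\<tau> k))"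
    unfolding of_real_sum by (intro sum.cong refl) (simp add: m(2))
  finally have "of_int (Vol v (K - {j})) * complex_of_real (\<tau> j)
      = (\<Sum>k\<in>K - {j}. of_int (\<mu> k (v k)) * of_real (\<tau> k))" by simp
  then have "(-1) powi deg c * (of_int (Vol v (K - {j})) * complex_of_real (\<tau> j))
      = (\<Sum>k\<in>K - {j}. of_int (\<mu> k (v k)) * ((-1) powi deg c * of_real (\<tau> k)))"
    by (simp add: sum_distrib_left mult_ac)
  then show ?thesis using K(2) by (simp add: weights mult_ac)
qed

section \<open>The derivative of the pairing\<close>

text \<open>A complex linear derivative is determined by its values on the coordinate vectors, and
  these are the partial derivatives.\<close>

lemma holomorphic_on_n_has_derivative:
  fixes f :: "complex ^ 'n::finite \<Rightarrow> complex"
  assumes "holomorphic_on_n f U" "x \<in> U"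
  shows "(f has_derivative (\<lambda>y. \<Sum>i\<in>UNIV. y $ i * partial_deriv i f x)) (at x)"
proof -
  obtain L where L: "(f has_derivative L) (at x)" "\<And>a y. L (a *s y) = a * L y"
    using assms by (auto simp: holomorphic_on_n_def)
  have lin: "linear L" using L(1) by (simp add: has_derivative_linear)
  have pd: "partial_deriv i f x = L (axis i 1)" for i
  proof -
    let ?h = "\<lambda>z. x + z *s (axis i 1 :: complex ^ 'n)"
    have "linear (\<lambda>z. z *s (axis i 1 :: complex ^ 'n))"
      by (intro linearI) (simp_all add: vec_eq_iff algebra_simps)
    then have "((\<lambda>z. z *s (axis i 1 :: complex ^ 'n)) has_derivative (\<lambda>z. z *s axis i 1)) (at 0)"
      by (simp add: linear_conv_bounded_linear bounded_linear_imp_has_derivative)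
    then have "(?h has_derivative (\<lambda>z. z *s axis i 1)) (at 0)"
      using has_derivative_add[OF has_derivative_const[of x]] by fastforce
    then have "((\<lambda>z. f (?h z)) has_derivative (\<lambda>z. L (z *s axis i 1))) (at 0)"
      by (rule has_derivative_compose) (simp add: L(1))
    then have "((\<lambda>z. f (?h z)) has_field_derivative L (axis i 1)) (at 0)"
      by (simp add: has_field_derivative_def L(2) mult_commute_abs)
    then show ?thesis unfolding partial_deriv_def by (rule DERIV_imp_deriv)
  qed
  have "L y = (\<Sum>i\<in>UNIV. y $ i * L (axis i 1))" for y
  proof -
    have "L y = L (\<Sum>i\<in>UNIV. (y $ i) *s axis i 1)" by (simp only: basis_expansion)
    also have "\<dots> = (\<Sum>i\<in>UNIV. L ((y $ i) *s axis i 1))" by (rule linear_sum[OF lin])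
    finally show ?thesis by (simp only: L(2))
  qed
  then have "L = (\<lambda>y. \<Sum>i\<in>UNIV. y $ i * partial_deriv i f x)"
    unfolding pd by (rule ext)
  then show ?thesis using L(1) by (simp only:)
qed

text \<open>Translating the index of a finite sum loses nothing because \<open>B\<close> contains
  both the support of \<open>h\<close> and its translate.\<close>

lemma sum_shift:
  fixes h F :: "'a::ab_group_add \<Rightarrow> 'b::semiring_0"
  assumes "finite B" "\<And>c. h c \<noteq> 0 \<Longrightarrow> c \<in> B \<and> c + s \<in> B"
  shows "(\<Sum>c\<in>B. h c * F (c + s)) = (\<Sum>c\<in>B. h (c - s) * F c)"
  by (rule sum.reindex_bij_witness_not_neutral[where S' = "{c \<in> B. h c = 0}"
        and T' = "{c \<in> B. h (c - s) = 0}" and i = "\<lambda>c. c - s" and j = "\<lambda>c. c + s"])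
    (use assms in \<open>auto dest: assms(2)\<close>)

text \<open>The algebra at one point: \<open>x\<close>, \<phi> and \<psi> are values there, and
  \<open>g\<close> stands for \<open>weight\<close>. The sum is the derivative in direction
  \<open>j\<close> after the shift equations have been substituted.\<close>

lemma pairing_derivative_vanishes:
  fixes v :: "'n::finite \<Rightarrow> int ^ 'r::finite" and x :: "'n \<Rightarrow> complex"
    and g :: "int ^ 'r \<Rightarrow> 'n set \<Rightarrow> complex" and \<phi> \<psi> :: "int ^ 'r \<Rightarrow> complex"
    and vol :: "'n set \<Rightarrow> int" and \<mu> :: "'n set \<Rightarrow> int ^ 'r \<Rightarrow> int"
  assumes B: "finite B" "\<And>c I i. card I = CARD('r) \<Longrightarrow> g c I \<noteq> 0 \<Longrightarrow> c \<in> B \<and> c + v i \<in> B"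
    and \<mu>: "\<And>I. card I = CARD('r) \<Longrightarrow> j \<in> I \<Longrightarrow> \<mu> I \<in> dual_lattice \<and> \<mu> I (v j) = vol I \<and>
      (\<forall>i\<in>I - {j}. \<mu> I (v i) = 0)"
    and rel: "\<And>K c. card K = Suc CARD('r) \<Longrightarrow> j \<in> K \<Longrightarrow>
      of_int (vol (K - {j})) * (g c (K - {j}) + g (c - v j) (K - {j}))
      = (\<Sum>k\<in>K - {j}. of_int (\<mu> (K - {k}) (v k)) * (g c (K - {k}) + g (c - v k) (K - {k})))"
    and \<phi>: "\<And>\<nu> c I. \<nu> \<in> dual_lattice \<Longrightarrow> card I = CARD('r) \<Longrightarrow> g c I \<noteq> 0 \<Longrightarrow>
      (\<Sum>i\<in>UNIV. of_int (\<nu> (v i)) * x i * \<phi> (c + v i)) + of_int (\<nu> c) * \<phi> c = 0"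
    and \<psi>: "\<And>\<nu> c I. \<nu> \<in> dual_lattice \<Longrightarrow> card I = CARD('r) \<Longrightarrow> g c I \<noteq> 0 \<Longrightarrow>
      (\<Sum>i\<in>UNIV. of_int (\<nu> (v i)) * x i * \<psi> (sum v I - c + v i)) + of_int (\<nu> (sum v I - c)) * \<psi> (sum v I - c) = 0"
  shows "(\<Sum>I | card I = CARD('r). \<Sum>c\<in>B. g c I * of_int (vol I) *
      (of_bool (j \<in> I) * prod x (I - {j}) * \<phi> c * \<psi> (sum v I - c)
       + prod x I * (\<phi> (c + v j) * \<psi> (sum v I - c) + \<phi> c * \<psi> (sum v I - c + v j)))) = 0"
proof -
  \<comment> \<open>\<open>G I i\<close> is what the shift equations make of the \<open>i\<close>th
    partial derivative of \<open>A I\<close>. Its terms are reindexed so that the two indices sum to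
    \<open>sum v I + v i\<close>, which depends only on K = insert i I when \<open>i\<close> is
    outside \<open>I\<close>.\<close>
  define A where "A I = (\<Sum>c\<in>B. g c I * (\<phi> c * \<psi> (sum v I - c)))" for I
  define G where "G I i = (\<Sum>c\<in>B. (g c I + g (c - v i) I) * (\<phi> c * \<psi> (sum v I + v i - c)))" for I i
  have G: "(\<Sum>c\<in>B. g c I * (\<phi> (c + v i) * \<psi> (sum v I - c) + \<phi> c * \<psi> (sum v I - c + v i))) = G I i"
    if I: "card I = CARD('r)" for I i
  proof -
    have "(\<Sum>c\<in>B. g c I * (\<phi> (c + v i) * \<psi> (sum v I + v i - (c + v i))))
        = (\<Sum>c\<in>B. g (c - v i) I * (\<phi> c * \<psi> (sum v I + v i - c)))"
      using sum_shift[of B "\<lambda>c. g c I" "v i" "\<lambda>c. \<phi> c * \<psi> (sum v I + v i - c)"] B I by simp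
    then show ?thesis by (simp add: G_def algebra_simps sum.distrib)
  qed
  \<comment> \<open>The Euler equations of \<phi> and \<psi> are added; the coefficient is constant
    in \<open>c\<close>, since \<mu> c + \<mu> (sum v I - c) = \<mu> (sum v I) = vol I.\<close>
  have E: "(\<Sum>i\<in>UNIV. of_int (\<mu> I (v i)) * x i * G I i) = - (of_int (vol I) * A I)"
    if I: "card I = CARD('r)" "j \<in> I" for I
  proof -
    have \<mu>I: "\<mu> I \<in> dual_lattice" using \<mu>[OF I] by simp
    interpret \<mu>: additive "\<mu> I" using \<mu>I by unfold_locales (auto simp: dual_lattice_def)
    have "\<mu> I (sum v I) = (\<Sum>i\<in>I. if i = j then vol I else 0)"
      unfolding \<mu>.sum using \<mu>[OF I] by (intro sum.cong) auto
    then have "\<mu> I (sum v I) = vol I" using I(2) by simp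
    then have vol: "of_int (vol I) = of_int (\<mu> I c) + (of_int (\<mu> I (sum v I - c)) :: complex)" for c
      by (simp add: \<mu>.diff)
    have "(\<Sum>i\<in>UNIV. of_int (\<mu> I (v i)) * x i * (g c I *
        (\<phi> (c + v i) * \<psi> (sum v I - c) + \<phi> c * \<psi> (sum v I - c + v i))))
        = - (of_int (vol I) * (g c I * (\<phi> c * \<psi> (sum v I - c))))" for c
    proof (cases "g c I = 0")
      case False
      have "(\<Sum>i\<in>UNIV. of_int (\<mu> I (v i)) * x i * (g c I *
        (\<phi> (c + v i) * \<psi> (sum v I - c) + \<phi> c * \<psi> (sum v I - c + v i))))
        = g c I * \<psi> (sum v I - c) * (\<Sum>i\<in>UNIV. of_int (\<mu> I (v i)) * x i * \<phi> (c + v i))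
          + g c I * \<phi> c * (\<Sum>i\<in>UNIV. of_int (\<mu> I (v i)) * x i * \<psi> (sum v I - c + v i))"
        by (simp add: sum_distrib_left algebra_simps sum.distrib)
      also have "(\<Sum>i\<in>UNIV. of_int (\<mu> I (v i)) * x i * \<phi> (c + v i)) = - (of_int (\<mu> I c) * \<phi> c)"
        using \<phi>[OF \<mu>I I(1) False] by (simp add: eq_neg_iff_add_eq_0)
      also have "(\<Sum>i\<in>UNIV. of_int (\<mu> I (v i)) * x i * \<psi> (sum v I - c + v i))
          = - (of_int (\<mu> I (sum v I - c)) * \<psi> (sum v I - c))"
        using \<psi>[OF \<mu>I I(1) False] by (simp add: eq_neg_iff_add_eq_0)
      finally show ?thesis unfolding vol[of c] by (simp add: algebra_simps)
    qed simp
    then have "(\<Sum>c\<in>B. \<Sum>i\<in>UNIV. of_int (\<mu> I (v i)) * x i * (g c I *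
        (\<phi> (c + v i) * \<psi> (sum v I - c) + \<phi> c * \<psi> (sum v I - c + v i)))) = - (of_int (vol I) * A I)"
      by (simp add: A_def sum_negf flip: sum_distrib_left)
    then show ?thesis
      by (subst (asm) sum.swap) (simp add: G[OF I(1)] flip: sum_distrib_left)
  qed
  have X: "prod x I = x i * prod x (I - {i})" if "i \<in> I" for I i
    using that by (simp add: prod.remove)
  \<comment> \<open>In \<open>E\<close> the indices of \<open>I\<close> other than \<open>j\<close>
    drop out and \<open>j\<close> contributes \<open>vol I\<close>. Multiplication by the monomial
    of I - {j} cancels the undifferentiated part \<open>A I\<close> and leaves terms with
    \<open>i\<close> outside \<open>I\<close>.\<close>
  have with_j: "of_int (vol I) * (prod x (I - {j}) * A I + prod x I * G I j)
      = - (\<Sum>i\<in>- I. of_int (\<mu> I (v i)) * prod x (insert i (I - {j})) * G I i)"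
    if I: "card I = CARD('r)" "j \<in> I" for I
  proof -
    have "(\<Sum>i\<in>UNIV. of_int (\<mu> I (v i)) * x i * G I i)
        = of_int (vol I) * x j * G I j + (\<Sum>i\<in>- I. of_int (\<mu> I (v i)) * x i * G I i)"
    proof -
      have "(\<Sum>i\<in>UNIV. of_int (\<mu> I (v i)) * x i * G I i)
        = (\<Sum>i\<in>insert j (- I). of_int (\<mu> I (v i)) * x i * G I i)"
        by (rule sum.mono_neutral_right) (use \<mu>[OF I] in auto)
      then show ?thesis using I \<mu>[OF I] by simp
    qed
    then have "of_int (vol I) * A I + of_int (vol I) * x j * G I j
        = - (\<Sum>i\<in>- I. of_int (\<mu> I (v i)) * x i * G I i)"
      unfolding E[OF I] by (simp add: eq_neg_iff_add_eq_0 neg_eq_iff_add_eq_0 ac_simps)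
    then have "prod x (I - {j}) * (of_int (vol I) * A I + of_int (vol I) * x j * G I j)
        = - (\<Sum>i\<in>- I. of_int (\<mu> I (v i)) * (x i * prod x (I - {j})) * G I i)"
      by (simp add: sum_distrib_left mult_ac)
    moreover have "prod x (insert i (I - {j})) = x i * prod x (I - {j})" if "i \<in> - I" for i
      using that by simp
    ultimately show ?thesis by (simp add: X[OF I(2)] algebra_simps)
  qed
  \<comment> \<open>Here K = insert j H. All \<open>G\<close> terms of the relation share the total
    \<open>sum v K\<close>, so \<open>rel\<close> applies to each \<open>c\<close>
    separately.\<close>
  have without_j: "of_int (vol H) * (prod x H * G H j)
      = (\<Sum>k\<in>H. of_int (\<mu> (insert j (H - {k})) (v k)) * prod x H * G (insert j (H - {k})) k)"
    if H: "card H = CARD('r)" "j \<notin> H" for H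
  proof -
    let ?K = "insert j H"
    have K: "card ?K = Suc CARD('r)" "?K - {j} = H" using H by auto
    have Kk: "insert j (H - {k}) = ?K - {k}" "sum v (?K - {k}) + v k = sum v ?K" if "k \<in> H" for k
    proof -
      show "insert j (H - {k}) = ?K - {k}" using that H by auto
      show "sum v (?K - {k}) + v k = sum v ?K" using that by (simp add: sum.remove[of ?K k] add.commute)
    qed
    note relH = rel[OF K(1) insertI1, unfolded K(2)]
    have "of_int (vol H) * G H j = (\<Sum>c\<in>B. of_int (vol H) *
        (g c H + g (c - v j) H) * (\<phi> c * \<psi> (sum v ?K - c)))"
      using H by (simp add: G_def sum_distrib_left mult.assoc add.commute)
    also have "\<dots> = (\<Sum>c\<in>B. (\<Sum>k\<in>H. of_int (\<mu> (?K - {k}) (v k)) *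
        (g c (?K - {k}) + g (c - v k) (?K - {k}))) * (\<phi> c * \<psi> (sum v ?K - c)))"
      by (simp only: relH)
    also have "\<dots> = (\<Sum>k\<in>H. of_int (\<mu> (?K - {k}) (v k)) * (\<Sum>c\<in>B.
        (g c (?K - {k}) + g (c - v k) (?K - {k})) * (\<phi> c * \<psi> (sum v ?K - c))))"
      unfolding sum_distrib_left sum_distrib_right by (subst sum.swap) (simp add: mult.assoc)
    also have "\<dots> = (\<Sum>k\<in>H. of_int (\<mu> (insert j (H - {k})) (v k)) * G (insert j (H - {k})) k)"
      by (intro sum.cong refl) (simp add: Kk G_def)
    finally have "prod x H * (of_int (vol H) * G H j)
        = prod x H * (\<Sum>k\<in>H. of_int (\<mu> (insert j (H - {k})) (v k)) * G (insert j (H - {k})) k)"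
      by simp
    then show ?thesis by (simp add: sum_distrib_left mult_ac)
  qed
  have "(\<Sum>c\<in>B. g c I * of_int (vol I) *
      (of_bool (j \<in> I) * prod x (I - {j}) * \<phi> c * \<psi> (sum v I - c)
       + prod x I * (\<phi> (c + v j) * \<psi> (sum v I - c) + \<phi> c * \<psi> (sum v I - c + v j))))
      = of_int (vol I) * (of_bool (j \<in> I) * prod x (I - {j}) * A I + prod x I * G I j)"
    if "card I = CARD('r)" for I
    unfolding A_def G[OF that, symmetric] sum_distrib_left sum.distrib[symmetric]
    by (intro sum.cong refl) (simp add: algebra_simps)
  then have "(\<Sum>I | card I = CARD('r). \<Sum>c\<in>B. g c I * of_int (vol I) *
      (of_bool (j \<in> I) * prod x (I - {j}) * \<phi> c * \<psi> (sum v I - c)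
       + prod x I * (\<phi> (c + v j) * \<psi> (sum v I - c) + \<phi> c * \<psi> (sum v I - c + v j))))
      = (\<Sum>I | card I = CARD('r). of_int (vol I) * (of_bool (j \<in> I) * prod x (I - {j}) * A I + prod x I * G I j))"
    by (intro sum.cong refl) simp
  also have "\<dots> = (\<Sum>I | card I = CARD('r) \<and> j \<in> I. of_int (vol I) * (prod x (I - {j}) * A I + prod x I * G I j))
      + (\<Sum>I | card I = CARD('r) \<and> j \<notin> I. of_int (vol I) * (prod x I * G I j))"
  proof -
    have "{I. card I = CARD('r)} = {I. card I = CARD('r) \<and> j \<in> I} \<union> {I. card I = CARD('r) \<and> j \<notin> I}" by auto
    then show ?thesis by (simp only:) (subst sum.union_disjoint; auto intro!: sum.cong arg_cong2[where f = "(+)"])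
  qed
  also have "\<dots> = - (\<Sum>I | card I = CARD('r) \<and> j \<in> I. \<Sum>i\<in>- I.
        of_int (\<mu> I (v i)) * prod x (insert i (I - {j})) * G I i)
      + (\<Sum>H | card H = CARD('r) \<and> j \<notin> H. \<Sum>k\<in>H.
        of_int (\<mu> (insert j (H - {k})) (v k)) * prod x H * G (insert j (H - {k})) k)"
    by (simp add: with_j without_j sum_negf)
  also have "(\<Sum>I | card I = CARD('r) \<and> j \<in> I. \<Sum>i\<in>- I.
        of_int (\<mu> I (v i)) * prod x (insert i (I - {j})) * G I i)
      = (\<Sum>H | card H = CARD('r) \<and> j \<notin> H. \<Sum>k\<in>H.
        of_int (\<mu> (insert j (H - {k})) (v k)) * prod x H * G (insert j (H - {k})) k)"
  proof -
    \<comment> \<open>Both index sets describe a set \<open>K\<close> of size r + 1 containing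
      \<open>j\<close>, with a second element i = k: on one side I = K - {i}, on the other H = K -
      {j}.\<close>
    have "(\<Sum>(I, i)\<in>(SIGMA I:{I. card I = CARD('r) \<and> j \<in> I}. - I).
        of_int (\<mu> I (v i)) * prod x (insert i (I - {j})) * G I i)
      = (\<Sum>(H, k)\<in>(SIGMA H:{H. card H = CARD('r) \<and> j \<notin> H}. H).
        of_int (\<mu> (insert j (H - {k})) (v k)) * prod x H * G (insert j (H - {k})) k)"
    proof (rule sum.reindex_bij_witness[where i = "\<lambda>(H, k). (insert j (H - {k}), k)"
          and j = "\<lambda>(I, i). (insert i (I - {j}), i)"])
      fix t assume "t \<in> (SIGMA I:{I. card I = CARD('r) \<and> j \<in> I}. - I)"
      then obtain I i where t: "t = (I, i)" "card I = CARD('r)" "j \<in> I" "i \<notin> I" by auto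
      then have *: "insert j (insert i (I - {j}) - {i}) = I" by auto
      have "card (insert i (I - {j})) = CARD('r)"
        using t by (simp add: card_Diff_singleton)
      then show "(case t of (I, i) \<Rightarrow> (insert i (I - {j}), i)) \<in> (SIGMA H:{H. card H = CARD('r) \<and> j \<notin> H}. H)"
        using t by auto
      show "(case case t of (I, i) \<Rightarrow> (insert i (I - {j}), i) of (H, k) \<Rightarrow> (insert j (H - {k}), k)) = t"
        using t * by simp
      show "(case case t of (I, i) \<Rightarrow> (insert i (I - {j}), i) of (H, k) \<Rightarrow>
          of_int (\<mu> (insert j (H - {k})) (v k)) * prod x H * G (insert j (H - {k})) k)
        = (case t of (I, i) \<Rightarrow> of_int (\<mu> I (v i)) * prod x (insert i (I - {j})) * G I i)"
        unfolding t(1) prod.case * ..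
    next
      fix t assume "t \<in> (SIGMA H:{H. card H = CARD('r) \<and> j \<notin> H}. H)"
      then obtain H k where t: "t = (H, k)" "card H = CARD('r)" "j \<notin> H" "k \<in> H" by auto
      then have *: "insert k (insert j (H - {k}) - {j}) = H" by auto
      have "card (insert j (H - {k})) = CARD('r)"
        using t by (simp add: card_Diff_singleton)
      then show "(case t of (H, k) \<Rightarrow> (insert j (H - {k}), k)) \<in> (SIGMA I:{I. card I = CARD('r) \<and> j \<in> I}. - I)"
        using t by auto
      show "(case case t of (H, k) \<Rightarrow> (insert j (H - {k}), k) of (I, i) \<Rightarrow> (insert i (I - {j}), i)) = t"
        using t * by simp
    qed
    then show ?thesis by (subst (1 2) sum.Sigma) auto
  qed
  finally show ?thesis by simp
qed

section \<open>Termwise differentiation and constancy of the pairing\<close>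

lemma has_derivative_prod_coordinates:
  fixes x :: "complex ^ 'n::finite"
  shows "((\<lambda>x. \<Prod>i\<in>I. x $ i) has_derivative
    (\<lambda>y. \<Sum>j\<in>UNIV. y $ j * (of_bool (j \<in> I) * prod (($) x) (I - {j})))) (at x)"
proof -
  have "((\<lambda>x. x $ i) has_derivative (\<lambda>y. y $ i)) (at x)" for i
    by (rule bounded_linear_imp_has_derivative) (rule bounded_linear_vec_nth)
  then have "((\<lambda>x. \<Prod>i\<in>I. x $ i) has_derivative
      (\<lambda>y. \<Sum>i\<in>I. y $ i * (\<Prod>j\<in>I - {i}. x $ j))) (at x)"
    by (rule has_derivative_prod)
  moreover have "(\<Sum>i\<in>I. y $ i * (\<Prod>j\<in>I - {i}. x $ j))
      = (\<Sum>j\<in>UNIV. y $ j * (of_bool (j \<in> I) * prod (($) x) (I - {j})))" for y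
    by (rule sum.mono_neutral_cong_left) auto
  ultimately show ?thesis by simp
qed

text \<open>Replaces the index set of triples by a product of a range for \<open>I\<close> and a
  fixed finite range for \<open>c\<close>, as needed for shifting \<open>c\<close>. The terms gained
  or lost have weight zero.\<close>

lemma pairing_eq_sum_weight:
  fixes v :: "'n::finite \<Rightarrow> int ^ 'r::finite"
  assumes C: "rational_polyhedral_cone C" and v: "\<And>i. to_real (v i) \<in> C" and w: "w \<in> interior C"
    and B: "finite B" "\<And>c I. card I = CARD('r) \<Longrightarrow> weight deg v w c I \<noteq> 0 \<Longrightarrow> c \<in> B"
  shows "pairing C deg v w \<Phi> \<Psi> x = (\<Sum>I | card I = CARD('r). \<Sum>c\<in>B.
    weight deg v w c I * of_int (Vol v I) * (\<Prod>i\<in>I. x $ i) * \<Phi> c x * \<Psi> (sum v I - c) x)"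
proof -
  let ?g = "\<lambda>c I. weight deg v w c I"
  have "(\<Sum>(c, d, I)\<in>pairing_index C v.
        xi deg v w c d I * of_int (Vol v I) * (\<Prod>i\<in>I. x $ i) * \<Phi> c x * \<Psi> d x)
      = (\<Sum>(I, c)\<in>(SIGMA I:{I. card I = CARD('r)}. B).
        ?g c I * of_int (Vol v I) * (\<Prod>i\<in>I. x $ i) * \<Phi> c x * \<Psi> (sum v I - c) x)"
  proof (rule sum.reindex_bij_witness_not_neutral[
        where S' = "{(c, d, I) \<in> pairing_index C v. ?g c I = 0}"
          and T' = "{(I, c) \<in> (SIGMA I:{I. card I = CARD('r)}. B). ?g c I = 0}"
          and i = "\<lambda>(I, c). (c, sum v I - c, I)" and j = "\<lambda>(c, d, I). (I, c)"])
    show "finite {(c, d, I) \<in> pairing_index C v. ?g c I = 0}"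
      by (rule finite_subset[OF _ finite_pairing_index[OF C, of v]]) auto
    have "finite (SIGMA I:{I :: 'n set. card I = CARD('r)}. B)" using B(1) by simp
    then show "finite {(I, c) \<in> (SIGMA I:{I :: 'n set. card I = CARD('r)}. B). ?g c I = 0}"
      by (rule rev_finite_subset) auto
  next
    fix t assume "t \<in> pairing_index C v - {(c, d, I) \<in> pairing_index C v. ?g c I = 0}"
    then obtain c d I where t: "t = (c, d, I)" "card I = CARD('r)" "c + d = sum v I" "?g c I \<noteq> 0"
      by (auto simp: pairing_index_def)
    then have d: "d = sum v I - c" by (simp add: algebra_simps)
    then show "(case case t of (c, d, I) \<Rightarrow> (I, c) of (I, c) \<Rightarrow> (c, sum v I - c, I)) = t"
      using t by simp
    show "(case t of (c, d, I) \<Rightarrow> (I, c)) \<in> (SIGMA I:{I. card I = CARD('r)}. B)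
        - {(I, c) \<in> (SIGMA I:{I. card I = CARD('r)}. B). ?g c I = 0}"
      using t B(2) by simp
  next
    fix t assume "t \<in> (SIGMA I:{I. card I = CARD('r)}. B)
        - {(I, c) \<in> (SIGMA I:{I. card I = CARD('r)}. B). ?g c I = 0}"
    then obtain I c where t: "t = (I, c)" "card I = CARD('r)" "?g c I \<noteq> 0" by auto
    then show "(case case t of (I, c) \<Rightarrow> (c, sum v I - c, I) of (c, d, I) \<Rightarrow> (I, c)) = t" by simp
    show "(case t of (I, c) \<Rightarrow> (c, sum v I - c, I)) \<in> pairing_index C v
        - {(c, d, I) \<in> pairing_index C v. ?g c I = 0}"
      using t weight_nonzero_imp_cone[OF C v w t(3)] by (simp add: pairing_index_def)
  next
    fix t assume "t \<in> {(c, d, I) \<in> pairing_index C v. ?g c I = 0}"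
    then show "(case t of (c, d, I) \<Rightarrow>
        xi deg v w c d I * of_int (Vol v I) * (\<Prod>i\<in>I. x $ i) * \<Phi> c x * \<Psi> d x) = 0"
      by (auto simp: pairing_index_def xi_eq_weight)
  next
    fix t assume "t \<in> pairing_index C v"
    then obtain c d I where t: "t = (c, d, I)" "c + d = sum v I"
      by (auto simp: pairing_index_def)
    then have d: "d = sum v I - c" by (simp add: algebra_simps)
    show "(case case t of (c, d, I) \<Rightarrow> (I, c) of (I, c) \<Rightarrow>
          ?g c I * of_int (Vol v I) * (\<Prod>i\<in>I. x $ i) * \<Phi> c x * \<Psi> (sum v I - c) x)
        = (case t of (c, d, I) \<Rightarrow>
          xi deg v w c d I * of_int (Vol v I) * (\<Prod>i\<in>I. x $ i) * \<Phi> c x * \<Psi> d x)"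
      using xi_eq_weight[OF t(2)] by (simp add: t(1) d)
  qed auto
  then show ?thesis
    unfolding pairing_def using B(1) by (simp add: sum.Sigma)
qed

lemma bbGKZ_solution_has_derivative:
  fixes v :: "'n::finite \<Rightarrow> int ^ 'r::finite"
  assumes "bbGKZ_solution v K U \<Phi>" "c \<in> cone_points K" "x \<in> U"
  shows "(\<Phi> c has_derivative (\<lambda>y. \<Sum>j\<in>UNIV. y $ j * \<Phi> (c + v j) x)) (at x)"
  using holomorphic_on_n_has_derivative[of "\<Phi> c" U x] assms by (simp add: bbGKZ_solution_def)

lemma bbGKZ_solution_euler:
  fixes v :: "'n::finite \<Rightarrow> int ^ 'r::finite"
  assumes "bbGKZ_solution v K U \<Phi>" "c \<in> cone_points K" "x \<in> U" "\<mu> \<in> dual_lattice"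
  shows "(\<Sum>i\<in>UNIV. of_int (\<mu> (v i)) * x $ i * \<Phi> (c + v i) x) + of_int (\<mu> c) * \<Phi> c x = 0"
proof -
  have "partial_deriv i (\<Phi> c) x = \<Phi> (c + v i) x" for i
    using assms unfolding bbGKZ_solution_def by blast
  moreover have "(\<Sum>i\<in>UNIV. of_int (\<mu> (v i)) * x $ i * partial_deriv i (\<Phi> c) x) + of_int (\<mu> c) * \<Phi> c x = 0"
    using assms unfolding bbGKZ_solution_def by blast
  ultimately show ?thesis by simp
qed

lemma has_derivative_pairing_term:
  fixes v :: "'n::finite \<Rightarrow> int ^ 'r::finite"
  assumes \<Phi>: "bbGKZ_solution v K U \<Phi>" "c \<in> cone_points K"
    and \<Psi>: "bbGKZ_solution v K' U \<Psi>" "d \<in> cone_points K'" and x: "x \<in> U"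
  shows "((\<lambda>x. a * (\<Prod>i\<in>I. x $ i) * \<Phi> c x * \<Psi> d x) has_derivative
    (\<lambda>y. \<Sum>j\<in>UNIV. y $ j * (a * (of_bool (j \<in> I) * prod (($) x) (I - {j}) * \<Phi> c x * \<Psi> d x
       + prod (($) x) I * (\<Phi> (c + v j) x * \<Psi> d x + \<Phi> c x * \<Psi> (d + v j) x))))) (at x)"
proof -
  have p: "((\<lambda>x. a * (\<Prod>i\<in>I. x $ i)) has_derivative
      (\<lambda>y. a * (\<Sum>j\<in>UNIV. y $ j * (of_bool (j \<in> I) * prod (($) x) (I - {j}))))) (at x)"
    by (rule has_derivative_mult_right) (rule has_derivative_prod_coordinates)
  note D = has_derivative_mult[OF has_derivative_mult[OF p bbGKZ_solution_has_derivative[OF \<Phi> x]]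
      bbGKZ_solution_has_derivative[OF \<Psi> x]]
  show ?thesis
    by (rule has_derivative_eq_rhs[OF D])
      (simp add: fun_eq_iff sum_distrib_left sum_distrib_right sum.distrib[symmetric] algebra_simps)
qed

theorem theorem2p4:
  fixes C :: "(real ^ 'r::finite) set"
    and deg :: "int ^ 'r \<Rightarrow> int"
    and v :: "'n::finite \<Rightarrow> int ^ 'r"
    and w :: "real ^ 'r"
    and U :: "(complex ^ 'n) set"
    and \<Phi> \<Psi> :: "int ^ 'r \<Rightarrow> complex ^ 'n \<Rightarrow> complex"
  assumes "deg \<in> dual_lattice"
    and "rational_polyhedral_cone C"
    and "dim C = CARD('r)"
    and "\<And>u. ray_generator C u \<Longrightarrow> deg u = 1"
    and "inj v"
    and "\<And>i. to_real (v i) \<in> C"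
    and "\<And>i. deg (v i) = 1"
    and "\<And>u. ray_generator C u \<Longrightarrow> u \<in> range v"
    and "w \<in> interior C"
    and "generic v w"
    and "open U"
    and "connected U"
    and "bbGKZ_solution v C U \<Phi>"
    and "bbGKZ_solution v (interior C) U \<Psi>"
  shows "finite (pairing_index C v) \<and> pairing C deg v w \<Phi> \<Psi> constant_on U"
proof
  show "finite (pairing_index C v)" using assms(2) by (rule finite_pairing_index)
  let ?g = "weight deg v w"
  define B0 where "B0 = {c. \<exists>I. card I = CARD('r) \<and> ?g c I \<noteq> 0}"
  note cone = weight_nonzero_imp_cone[OF assms(2,6,9)]
  have "B0 \<subseteq> fst ` pairing_index C v"
  proof
    fix c assume "c \<in> B0"
    then obtain I where I: "card I = CARD('r)" "?g c I \<noteq> 0" by (auto simp: B0_def)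
    then have "(c, sum v I - c, I) \<in> pairing_index C v"
      using cone[OF I(2)] by (simp add: pairing_index_def)
    then show "c \<in> fst ` pairing_index C v" by force
  qed
  then have "finite B0" by (rule finite_subset) (use assms(2) in \<open>simp add: finite_pairing_index\<close>)
  \<comment> \<open>The support is enlarged by all its translates by the \<open>v i\<close>, so that
    derivatives can be reindexed within \<open>B\<close>.\<close>
  define B where "B = B0 \<union> (\<Union>i. (\<lambda>c. c + v i) ` B0)"
  have B: "finite B" "\<And>c I. card I = CARD('r) \<Longrightarrow> ?g c I \<noteq> 0 \<Longrightarrow> c \<in> B"
    "\<And>c I i. card I = CARD('r) \<Longrightarrow> ?g c I \<noteq> 0 \<Longrightarrow> c + v i \<in> B"
  proof -
    show "finite B" using \<open>finite B0\<close> by (simp add: B_def)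
    fix c I i assume "card I = CARD('r)" "?g c I \<noteq> 0"
    then have "c \<in> B0" by (auto simp: B0_def)
    then show "c \<in> B" "c + v i \<in> B" by (auto simp: B_def)
  qed
  define T where "T x j I c = ?g c I * of_int (Vol v I) *
      (of_bool (j \<in> I) * prod (($) x) (I - {j}) * \<Phi> c x * \<Psi> (sum v I - c) x
       + prod (($) x) I * (\<Phi> (c + v j) x * \<Psi> (sum v I - c) x + \<Phi> c x * \<Psi> (sum v I - c + v j) x))"
    for x j I c
  have vanish: "(\<Sum>I | card I = CARD('r). \<Sum>c\<in>B. T x j I c) = 0" if x: "x \<in> U" for x j
  proof -
    have "\<forall>I. \<exists>\<mu>. card I = CARD('r) \<and> j \<in> I \<longrightarrow> \<mu> \<in> dual_lattice \<and> \<mu> (v j) = Vol v I \<and>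
        (\<forall>i\<in>I - {j}. \<mu> (v i) = 0) \<and> (\<forall>i. i \<notin> I \<longrightarrow> \<bar>\<mu> (v i)\<bar> = Vol v (insert i (I - {j})))"
      using exists_cofactor_functional[of _ j v] by metis
    then obtain \<mu> where \<mu>: "\<And>I. card I = CARD('r) \<Longrightarrow> j \<in> I \<Longrightarrow> \<mu> I \<in> dual_lattice \<and> \<mu> I (v j) = Vol v I \<and>
        (\<forall>i\<in>I - {j}. \<mu> I (v i) = 0) \<and> (\<forall>i. i \<notin> I \<longrightarrow> \<bar>\<mu> I (v i)\<bar> = Vol v (insert i (I - {j})))"
      by metis
    show ?thesis
      unfolding T_def
    proof (rule pairing_derivative_vanishes[where \<mu> = \<mu> and vol = "Vol v"])
      fix K c assume K: "card K = Suc CARD('r)" "j \<in> K"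
      show "of_int (Vol v (K - {j})) * (?g c (K - {j}) + ?g (c - v j) (K - {j}))
        = (\<Sum>k\<in>K - {j}. of_int (\<mu> (K - {k}) (v k)) * (?g c (K - {k}) + ?g (c - v k) (K - {k})))"
      proof (rule weight_relation[OF assms(1,7,5,10) K])
        fix k assume k: "k \<in> K - {j}"
        have Kk: "card (K - {k}) = CARD('r)" "j \<in> K - {k}" using K k by auto
        \<comment> \<open>The set exchanged for K - {k} is the same K - {j} for every
          \<open>k\<close>, so all the functionals have the one volume of K - {j} as absolute value
          at \<open>v k\<close>.\<close>
        have ins: "insert k (K - {k} - {j}) = K - {j}" using k by auto
        show "\<mu> (K - {k}) \<in> dual_lattice" "\<mu> (K - {k}) (v j) = Vol v (K - {k})"
          using \<mu>[OF Kk] by simp_all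
        show "\<mu> (K - {k}) (v i) = 0" if "i \<in> K - {k, j}" for i
          using \<mu>[OF Kk] that by simp
        show "\<bar>\<mu> (K - {k}) (v k)\<bar> = Vol v (K - {j})"
          using \<mu>[OF Kk] ins by simp
      qed
    next
      fix \<nu> :: "int ^ 'r \<Rightarrow> int" and c and I :: "'n set"
      assume \<nu>: "\<nu> \<in> dual_lattice" and g: "?g c I \<noteq> 0"
      show "(\<Sum>i\<in>UNIV. of_int (\<nu> (v i)) * x $ i * \<Phi> (c + v i) x) + of_int (\<nu> c) * \<Phi> c x = 0"
        by (rule bbGKZ_solution_euler[OF assms(13) cone(1)[OF g] x \<nu>])
      show "(\<Sum>i\<in>UNIV. of_int (\<nu> (v i)) * x $ i * \<Psi> (sum v I - c + v i) x)
          + of_int (\<nu> (sum v I - c)) * \<Psi> (sum v I - c) x = 0"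
        by (rule bbGKZ_solution_euler[OF assms(14) cone(2)[OF g] x \<nu>])
    qed (use B \<mu> in auto)
  qed
  have "(pairing C deg v w \<Phi> \<Psi> has_derivative (\<lambda>y. 0)) (at x)" if x: "x \<in> U" for x
  proof -
    have "((\<lambda>x. ?g c I * of_int (Vol v I) * (\<Prod>i\<in>I. x $ i) * \<Phi> c x * \<Psi> (sum v I - c) x)
        has_derivative (\<lambda>y. \<Sum>j\<in>UNIV. y $ j * T x j I c)) (at x)" for c I
    \<comment> \<open>A term of weight zero is identically zero; this covers the indices in
      \<open>B\<close> outside the cones, where nothing is known about \<Phi> or \<Psi>.\<close>
    proof (cases "?g c I = 0")
      case True
      then show ?thesis by (simp add: T_def)
    next
      case False
      show ?thesis
        unfolding T_def by (rule has_derivative_pairing_term[OF assms(13) cone(1)[OF False] assms(14) cone(2)[OF False] x])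
    qed
    then have "((\<lambda>x. \<Sum>I | card I = CARD('r). \<Sum>c\<in>B.
          ?g c I * of_int (Vol v I) * (\<Prod>i\<in>I. x $ i) * \<Phi> c x * \<Psi> (sum v I - c) x)
        has_derivative (\<lambda>y. \<Sum>I | card I = CARD('r). \<Sum>c\<in>B. \<Sum>j\<in>UNIV. y $ j * T x j I c)) (at x)"
      by (intro has_derivative_sum)
    moreover have "(\<Sum>I | card I = CARD('r). \<Sum>c\<in>B. \<Sum>j\<in>UNIV. y $ j * T x j I c) = 0" for y
    proof -
      have "(\<Sum>I | card I = CARD('r). \<Sum>c\<in>B. \<Sum>j\<in>UNIV. y $ j * T x j I c)
          = (\<Sum>I | card I = CARD('r). \<Sum>j\<in>UNIV. \<Sum>c\<in>B. y $ j * T x j I c)"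
        by (intro sum.cong refl) (rule sum.swap)
      also have "\<dots> = (\<Sum>j\<in>UNIV. y $ j * (\<Sum>I | card I = CARD('r). \<Sum>c\<in>B. T x j I c))"
        unfolding sum_distrib_left by (rule sum.swap)
      finally show ?thesis by (simp add: vanish[OF x])
    qed
    moreover have "pairing C deg v w \<Phi> \<Psi> = (\<lambda>x. \<Sum>I | card I = CARD('r). \<Sum>c\<in>B.
        ?g c I * of_int (Vol v I) * (\<Prod>i\<in>I. x $ i) * \<Phi> c x * \<Psi> (sum v I - c) x)"
      by (intro ext pairing_eq_sum_weight assms(2,6,9) B(1,2))
    ultimately show ?thesis by simp
  qed
  then show "pairing C deg v w \<Phi> \<Psi> constant_on U"
    using has_derivative_zero_unique_connected[OF assms(11,12)] unfolding constant_on_def by metis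
qed

end
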